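(* Let $\mathrm{V}$ be a finite vertex set with $|\mathrm{V}|\ge 4$, let $\mathfrak{G}$ be the class of all MPDAGs over $\mathrm{V}$, and let $\mathcal{L}=(\mathfrak{G},\preceq)$ be the poset with $\mathcal{G}_1\preceq\mathcal{G}_2$ if and only if $\mathcal{M}^{\mathrm{c}}_{\mathrm{MPDAG}}(\mathcal{G}_1)\subseteq\mathcal{M}^{\mathrm{c}}_{\mathrm{MPDAG}}(\mathcal{G}_2)$. Then $\mathcal{L}$ is not graded.
   Context: Graphs. Two DAGs over $\mathrm{V}$ are Markov equivalent if they have the same skeleton and the same v-structures ($a\to b\leftarrow c$ with $a,c$ nonadjacent). An MPDAG $\mathcal{G}$ (maximally oriented partially directed acyclic graph) represents a nonempty set $[\mathcal{G}]$ of DAGs, namely all DAGs in some Markov equivalence class that agree with a given (possibly empty) set of edge orientations (background knowledge): $\mathcal{G}$ has the common skeleton; an edge is directed $u\to v$ if it is so in every DAG of $[\mathcal{G}]$, and undirected otherwise. Causal model. For each $v\in\mathrm{V}$ let $\mathcal{X}_v$ be a state space, infinite or finite with at least two elements; $\mathcal{X}_{\mathrm{I}}=\prod_{v\in\mathrm{I}}\mathcal{X}_v$ for $\mathrm{I}\subseteq\mathrm{V}$, and $\mathcal{X}=\mathcal{X}_{\mathrm{V}}$ is equipped with a suitable product $\sigma$-algebra. The potential outcome schedule is the stochastic process $X(\cdot)=(X_v(x_{\mathrm{I}}):v\in\mathrm{V},\mathrm{I}\subseteq\mathrm{V},x_{\mathrm{I}}\in\mathcal{X}_{\mathrm{I}})$,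 where the $\mathcal{X}_v$-valued $X_v(x_{\mathrm{I}})$ is the potential outcome of variable $v$ under the intervention imposing $x_{\mathrm{I}}$ on $X_{\mathrm{I}}$. The space in which $X(\cdot)$ takes values is assumed to carry a suitable $\sigma$-algebra; $P$ denotes the law of $X(\cdot)$ and is assumed to admit the regular conditional probability distributions used below. Write $X_{\mathrm{J}}(x_{\mathrm{I}})=(X_v(x_{\mathrm{I}}))_{v\in\mathrm{J}}$ and $X(x_{\mathrm{I}})=X_{\mathrm{V}}(x_{\mathrm{I}})$. The ground causal model $\mathcal{M}^{\mathrm{c}}$ is the set of laws $P$ satisfying consistency: for all disjoint $\mathrm{I},\mathrm{I}'\subseteq\mathrm{V}$ and each $x\in\mathcal{X}$, $P\big(X(x_{\mathrm{I}},x_{\mathrm{I}'})=X(x_{\mathrm{I}})\mid X_{\mathrm{I}'}(x_{\mathrm{I}})=x_{\mathrm{I}'}\big)=1$. For a DAG $\mathcal{D}$ with parent sets $\mathrm{Pa}(v)=\{w:w\to v\}$, $\mathcal{M}^{\mathrm{c}}_{\mathrm{DAG}}(\mathcal{D})$ is the set of $P\in\mathcal{M}^{\mathrm{c}}$ such that: (i) for every $v\in\mathrm{V}$, $\mathrm{I}\subseteq\mathrm{V}$ and $x\in\mathcal{X}$, $P\big\{X_v(x_{\mathrm{I}})=X_v\big(x_{\mathrm{Pa}(v)\cap\mathrm{I}},X_{\mathrm{Pa}(v)\setminus\mathrm{I}}(x_{\mathrm{I}})\big)\big\}=1$; (iii) for every $x\in\mathcal{X}$, the variables $(X_v(x_{\mathrm{Pa}(v)}):v\in\mathrm{V})$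 are mutually independent under $P$. $\mathcal{M}^{\mathrm{c}}_{\mathrm{MPDAG}}(\mathcal{G})=\bigcup_{\mathcal{D}\in[\mathcal{G}]}\mathcal{M}^{\mathrm{c}}_{\mathrm{DAG}}(\mathcal{D})$. Poset terms: $x\lessdot y$ ($y$ covers $x$) if $x\prec y$ with nothing strictly between. A poset is connected if any two elements are joined by a sequence whose consecutive elements are in a covering relation. A connected poset is graded if it admits a function $\mathrm{rank}$ to $\mathbb{N}$ such that $x\lessdot y$ implies $\mathrm{rank}(y)=\mathrm{rank}(x)+1$, and $\mathrm{rank}(x)=0$ for some minimal element $x$. *)

theory Defs
  imports "HOL-Probability.Probability"
begin

section \<open>DAGs, Markov equivalence and MPDAGs\<close>

type_synonym 'v digraph = "('v \<times> 'v) set"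

definition dags :: "'v set \<Rightarrow> 'v digraph set" where
  "dags V = {D. D \<subseteq> V \<times> V \<and> acyclic D}"

definition parents :: "'v digraph \<Rightarrow> 'v \<Rightarrow> 'v set" where
  "parents D v = {w. (w, v) \<in> D}"

definition skeleton :: "'v digraph \<Rightarrow> 'v set set" where
  "skeleton D = {{u, v} | u v. (u, v) \<in> D}"

definition v_structures :: "'v digraph \<Rightarrow> ('v \<times> 'v \<times> 'v) set" where
  "v_structures D = {(a, b, c). (a, b) \<in> D \<and> (c, b) \<in> D \<and> a \<noteq> c \<and> {a, c} \<notin> skeleton D}"

definition markov_equivalent :: "'v digraph \<Rightarrow> 'v digraph \<Rightarrow> bool" where
  "markov_equivalent D D' \<longleftrightarrow> skeleton D = skeleton D' \<and> v_structures D = v_structures D'"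

text \<open>
  The set \<open>K\<close> of edge orientations is the background knowledge.
\<close>

definition compatible_dags :: "'v set \<Rightarrow> 'v digraph \<Rightarrow> 'v digraph \<Rightarrow> 'v digraph set" where
  "compatible_dags V D0 K = {D \<in> dags V. markov_equivalent D D0 \<and> K \<subseteq> D}"

datatype 'v pdag = PDAG (directed: "('v \<times> 'v) set") (undirected: "'v set set")

definition pdag_of :: "'v digraph set \<Rightarrow> 'v pdag" where
  "pdag_of \<D> = PDAG (\<Inter>\<D>)
     {{u, v} | u v. {u, v} \<in> (\<Union>D\<in>\<D>. skeleton D) \<and> (u, v) \<notin> \<Inter>\<D> \<and> (v, u) \<notin> \<Inter>\<D>}"

definition represents :: "'v set \<Rightarrow> 'v pdag \<Rightarrow> 'v digraph set \<Rightarrow> bool" where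
  "represents V G \<D> \<longleftrightarrow>
     (\<exists>D0\<in>dags V. \<exists>K. \<D> = compatible_dags V D0 K) \<and> \<D> \<noteq> {} \<and> G = pdag_of \<D>"

definition mpdags :: "'v set \<Rightarrow> 'v pdag set" where
  "mpdags V = {G. \<exists>\<D>. represents V G \<D>}"

definition represented_dags :: "'v set \<Rightarrow> 'v pdag \<Rightarrow> 'v digraph set" where
  "represented_dags V G = (THE \<D>. represents V G \<D>)"

text \<open>
  An MPDAG determines the set of DAGs it represents, so the definite description above
  denotes that set.
\<close>

lemma represents_skeleton:
  assumes "represents V G \<D>" "D \<in> \<D>"
  shows "skeleton D = {{u, v} | u v. (u, v) \<in> directed G} \<union> undirected G"
proof -
  obtain D0 K where *: "\<D> = compatible_dags V D0 K" and G: "G = pdag_of \<D>"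
    using assms(1) by (auto simp: represents_def)
  have sk: "skeleton D' = skeleton D" if "D' \<in> \<D>" for D'
    using that assms(2) by (auto simp: * compatible_dags_def markov_equivalent_def)
  have U: "(\<Union>D\<in>\<D>. skeleton D) = skeleton D"
    using sk assms(2) by blast
  have sub: "(u, v) \<in> D" if "(u, v) \<in> \<Inter>\<D>" for u v
    using assms(2) that by blast
  show ?thesis
  proof (intro equalityI subsetI)
    fix e assume e: "e \<in> skeleton D"
    then obtain u v where uv: "e = {u, v}" "(u, v) \<in> D"
      by (auto simp: skeleton_def)
    show "e \<in> {{u, v} | u v. (u, v) \<in> directed G} \<union> undirected G"
    proof (cases "(u, v) \<in> \<Inter>\<D> \<or> (v, u) \<in> \<Inter>\<D>")
      case True
      then have "\<exists>u v. e = {u, v} \<and> (u, v) \<in> \<Inter>\<D>"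
        using uv(1) by (metis insert_commute)
      then show ?thesis by (simp add: G pdag_of_def)
    next
      case False
      then have "\<exists>u v. e = {u, v} \<and> {u, v} \<in> skeleton D \<and> (u, v) \<notin> \<Inter>\<D> \<and> (v, u) \<notin> \<Inter>\<D>"
        using uv(1) e by metis
      then show ?thesis by (simp add: G pdag_of_def U del: Inter_iff)
    qed
  next
    fix e assume "e \<in> {{u, v} | u v. (u, v) \<in> directed G} \<union> undirected G"
    then consider u v where "e = {u, v}" "(u, v) \<in> \<Inter>\<D>" | "e \<in> skeleton D"
      unfolding G pdag_of_def pdag.sel U by blast
    then show "e \<in> skeleton D"
    proof cases
      case (1 u v)
      then show ?thesis using sub[of u v] unfolding skeleton_def by blast
    qed
  qed
qed

lemma represents_eq:
  assumes "represents V G \<D>" "D \<in> \<D>"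
  shows "\<D> = {D' \<in> dags V. markov_equivalent D' D \<and> directed G \<subseteq> D'}"
proof -
  obtain D0 K where *: "\<D> = compatible_dags V D0 K" and G: "G = pdag_of \<D>"
    using assms(1) by (auto simp: represents_def)
  have dir: "directed G = \<Inter>\<D>" by (simp add: G pdag_of_def)
  have "K \<subseteq> \<Inter>\<D>" by (auto simp: * compatible_dags_def)
  moreover have "markov_equivalent D' D0 \<longleftrightarrow> markov_equivalent D' D" for D'
    using assms(2) by (simp add: * compatible_dags_def markov_equivalent_def)
  ultimately show ?thesis
    unfolding dir unfolding * compatible_dags_def by blast
qed

lemma represents_v_structures:
  assumes "represents V G \<D>" "D \<in> \<D>"
  shows "v_structures D = {(a, b, c). (a, b) \<in> directed G \<and> (c, b) \<in> directed G \<and> a \<noteq> c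
           \<and> {a, c} \<notin> skeleton D}"
proof -
  obtain D0 K where *: "\<D> = compatible_dags V D0 K" and G: "G = pdag_of \<D>"
    using assms(1) by (auto simp: represents_def)
  have vs: "v_structures D' = v_structures D" if "D' \<in> \<D>" for D'
    using that assms(2) by (auto simp: * compatible_dags_def markov_equivalent_def)
  have "(a, b) \<in> \<Inter>\<D> \<and> (c, b) \<in> \<Inter>\<D>" if "(a, b, c) \<in> v_structures D" for a b c
  proof -
    have "(a, b, c) \<in> v_structures D'" if "D' \<in> \<D>" for D'
      using vs[OF that] \<open>(a, b, c) \<in> v_structures D\<close> by simp
    then show ?thesis by (simp add: v_structures_def)
  qed
  moreover have "\<Inter>\<D> \<subseteq> D" using assms(2) by blast
  moreover have "directed G = \<Inter>\<D>" by (simp add: G pdag_of_def)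
  ultimately show ?thesis unfolding v_structures_def by blast
qed

lemma represents_unique:
  assumes "represents V G \<D>" "represents V G \<D>'"
  shows "\<D> = \<D>'"
proof -
  obtain D D' where D: "D \<in> \<D>" "D' \<in> \<D>'"
    using assms by (auto simp: represents_def)
  have "skeleton D = skeleton D'"
    by (simp only: represents_skeleton[OF assms(1) D(1)] represents_skeleton[OF assms(2) D(2)])
  then have "markov_equivalent D'' D \<longleftrightarrow> markov_equivalent D'' D'" for D''
    by (simp only: markov_equivalent_def represents_v_structures[OF assms(1) D(1)]
        represents_v_structures[OF assms(2) D(2)])
  then show ?thesis
    by (simp only: represents_eq[OF assms(1) D(1)] represents_eq[OF assms(2) D(2)])
qed

lemma represented_dags_eq: "represents V G \<D> \<Longrightarrow> represented_dags V G = \<D>"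
  unfolding represented_dags_def by (metis represents_unique the_equality)


section \<open>State spaces and potential outcome schedules\<close>

text \<open>
  All state spaces live in one type; \<open>S v\<close> provides the state space of \<open>v\<close> and its
  \<open>\<sigma>\<close>-algebra (the measure carried by \<open>S v\<close> plays no role). Countable separation holds for
  countable discrete and for standard Borel spaces; it makes events of the form
  \<open>{\<omega>. Y \<omega> = Z \<omega>}\<close> measurable.
\<close>

definition countably_separated :: "'x measure \<Rightarrow> bool" where
  "countably_separated M \<longleftrightarrow>
     (\<exists>\<C>\<subseteq>sets M. countable \<C> \<and> (\<forall>x\<in>space M. \<forall>y\<in>space M. x \<noteq> y \<longrightarrow> (\<exists>C\<in>\<C>. x \<in> C \<longleftrightarrow> y \<notin> C)))"

definition state_spaces :: "'v set \<Rightarrow> ('v \<Rightarrow> 'x measure) \<Rightarrow> bool" where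
  "state_spaces V S \<longleftrightarrow>
     (\<forall>v\<in>V. (infinite (space (S v)) \<or> card (space (S v)) \<ge> 2) \<and> countably_separated (S v))"

text \<open>
  An intervention imposing \<open>x\<^sub>I\<close> is the partial map with domain \<open>I\<close>, and joint interventions
  on disjoint sets are combined by \<open>++\<close>.
\<close>

type_synonym ('v, 'x) schedule = "'v \<times> ('v \<rightharpoonup> 'x) \<Rightarrow> 'x"

definition setting :: "('v \<Rightarrow> 'x) \<Rightarrow> 'v set \<Rightarrow> ('v \<rightharpoonup> 'x)" where
  "setting x I = (\<lambda>v. if v \<in> I then Some (x v) else None)"

definition interventions :: "'v set \<Rightarrow> ('v \<Rightarrow> 'x measure) \<Rightarrow> ('v \<rightharpoonup> 'x) set" where
  "interventions V S = {setting x I | x I. I \<subseteq> V \<and> x \<in> space (Pi\<^sub>M I S)}"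

definition schedules :: "'v set \<Rightarrow> ('v \<Rightarrow> 'x measure) \<Rightarrow> ('v, 'x) schedule set" where
  "schedules V S = (\<Pi>\<^sub>E (v, m)\<in>V \<times> interventions V S. space (S v))"

text \<open>
  For a schedule \<open>\<omega>\<close>, \<open>\<omega> (v, setting x I)\<close> is \<open>X\<^sub>v(x\<^sub>I)\<close> and \<open>outcomes J (setting x I) \<omega>\<close> is
  \<open>X\<^sub>J(x\<^sub>I)\<close>.
\<close>

definition outcomes :: "'v set \<Rightarrow> ('v \<rightharpoonup> 'x) \<Rightarrow> ('v, 'x) schedule \<Rightarrow> 'v \<Rightarrow> 'x" where
  "outcomes J m \<omega> = (\<lambda>v\<in>J. \<omega> (v, m))"

text \<open>
  A \<open>\<sigma>\<close>-algebra on the space of schedules is suitable if the potential outcomes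
  \<open>X\<^sub>v(x\<^sub>J, X\<^sub>K(x\<^sub>I))\<close>, with \<open>J \<subseteq> I\<close> and \<open>K \<inter> I = {}\<close>, are random variables. The case \<open>J = I\<close>,
  \<open>K = {}\<close> covers the coordinates \<open>X\<^sub>v(x\<^sub>I)\<close>. For uncountable state spaces the product
  \<open>\<sigma>\<close>-algebra of the coordinates is in general too small for this, hence it is not
  fixed here.
\<close>

definition suitable_schedule_space ::
    "'v set \<Rightarrow> ('v \<Rightarrow> 'x measure) \<Rightarrow> ('v, 'x) schedule measure \<Rightarrow> bool" where
  "suitable_schedule_space V S A \<longleftrightarrow>
     space A = schedules V S \<and>
     (\<forall>v\<in>V. \<forall>I\<subseteq>V. \<forall>J\<subseteq>I. \<forall>K\<subseteq>V - I. \<forall>x\<in>space (Pi\<^sub>M V S).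
        (\<lambda>\<omega>. \<omega> (v, setting x J ++ setting (outcomes K (setting x I) \<omega>) K)) \<in> measurable A (S v))"


section \<open>Causal models\<close>

definition regular_conditional_distribution ::
    "'a measure \<Rightarrow> 'b measure \<Rightarrow> ('a \<Rightarrow> 'b) \<Rightarrow> ('b \<Rightarrow> 'a measure) \<Rightarrow> bool" where
  "regular_conditional_distribution P N Y \<kappa> \<longleftrightarrow>
     \<kappa> \<in> measurable N (prob_algebra P) \<and>
     (\<forall>B\<in>sets P. \<forall>C\<in>sets N.
        emeasure P (B \<inter> (Y -` C \<inter> space P)) = (\<integral>\<^sup>+y\<in>C. emeasure (\<kappa> y) B \<partial>distr P N Y))"

text \<open>
  \<open>\<kappa> b\<close> is the conditional law of the schedule given \<open>X\<^sub>I\<^sub>'(a\<^sub>I) = b\<close>. Conditional laws are only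
  determined up to null sets of conditioning values, so consistency asks for one
  version that works for every \<open>b\<close>.
\<close>

definition consistent :: "'v set \<Rightarrow> ('v \<Rightarrow> 'x measure) \<Rightarrow> ('v, 'x) schedule measure \<Rightarrow> bool" where
  "consistent V S P \<longleftrightarrow>
     (\<forall>I\<subseteq>V. \<forall>I'\<subseteq>V. I \<inter> I' = {} \<longrightarrow>
       (\<forall>a\<in>space (Pi\<^sub>M I S). \<exists>\<kappa>.
          regular_conditional_distribution P (Pi\<^sub>M I' S) (outcomes I' (setting a I)) \<kappa> \<and>
          (\<forall>b\<in>space (Pi\<^sub>M I' S). AE \<omega> in \<kappa> b.
             outcomes V (setting a I ++ setting b I') \<omega> = outcomes V (setting a I) \<omega>)))"

definition causal_model ::
    "'v set \<Rightarrow> ('v \<Rightarrow> 'x measure) \<Rightarrow> ('v, 'x) schedule measure \<Rightarrow> ('v, 'x) schedule measure set" where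
  "causal_model V S A = {P. prob_space P \<and> sets P = sets A \<and> consistent V S P}"

definition dag_model ::
    "'v set \<Rightarrow> ('v \<Rightarrow> 'x measure) \<Rightarrow> ('v, 'x) schedule measure \<Rightarrow> 'v digraph
      \<Rightarrow> ('v, 'x) schedule measure set" where
  "dag_model V S A D = {P \<in> causal_model V S A.
     (\<forall>v\<in>V. \<forall>I\<subseteq>V. \<forall>x\<in>space (Pi\<^sub>M V S). AE \<omega> in P.
        \<omega> (v, setting x I) =
        \<omega> (v, setting x (parents D v \<inter> I) ++
                setting (outcomes (parents D v - I) (setting x I) \<omega>) (parents D v - I))) \<and>
     (\<forall>x\<in>space (Pi\<^sub>M V S).
        prob_space.indep_vars P S (\<lambda>v \<omega>. \<omega> (v, setting x (parents D v))) V)}"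

definition mpdag_model ::
    "'v set \<Rightarrow> ('v \<Rightarrow> 'x measure) \<Rightarrow> ('v, 'x) schedule measure \<Rightarrow> 'v pdag
      \<Rightarrow> ('v, 'x) schedule measure set" where
  "mpdag_model V S A G = (\<Union>D\<in>represented_dags V G. dag_model V S A D)"

definition mpdag_order ::
    "'v set \<Rightarrow> ('v \<Rightarrow> 'x measure) \<Rightarrow> ('v, 'x) schedule measure \<Rightarrow> 'v pdag rel" where
  "mpdag_order V S A = {(G1, G2) \<in> mpdags V \<times> mpdags V. mpdag_model V S A G1 \<subseteq> mpdag_model V S A G2}"


section \<open>Graded posets\<close>

text \<open>A poset is given by a carrier and its (reflexive) order relation.\<close>

definition covers :: "'a rel \<Rightarrow> 'a \<Rightarrow> 'a \<Rightarrow> bool" where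
  "covers r x y \<longleftrightarrow> (x, y) \<in> r \<and> x \<noteq> y \<and>
     \<not> (\<exists>z. (x, z) \<in> r \<and> x \<noteq> z \<and> (z, y) \<in> r \<and> z \<noteq> y)"

definition connected_poset :: "'a set \<Rightarrow> 'a rel \<Rightarrow> bool" where
  "connected_poset A r \<longleftrightarrow>
     (\<forall>x\<in>A. \<forall>y\<in>A. (x, y) \<in> {(a, b). covers r a b \<or> covers r b a}\<^sup>*)"

definition graded_poset :: "'a set \<Rightarrow> 'a rel \<Rightarrow> bool" where
  "graded_poset A r \<longleftrightarrow> connected_poset A r \<and>
     (\<exists>rank :: 'a \<Rightarrow> nat.
        (\<forall>x\<in>A. \<forall>y\<in>A. covers r x y \<longrightarrow> rank y = rank x + 1) \<and>
        (\<exists>x\<in>A. (\<forall>y\<in>A. (y, x) \<in> r \<longrightarrow> y = x) \<and> rank x = 0))"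

end

theory Submission
  imports Defs
begin

text \<open>
  The rank would be strictly increasing along the order, and already three vertices \<open>a\<close>, \<open>b\<close>, \<open>c\<close>
  give two chains that contradict this. Write \<open>P\<close> for the MPDAG \<open>b \<midarrow> a \<rightarrow> c\<close>. The undirected path
  \<open>b \<midarrow> a \<midarrow> c\<close> covers \<open>P\<close>, and the undirected triangle covers the undirected path, so the triangle
  has rank \<open>rank P + 2\<close>. But adding \<open>b \<rightarrow> c\<close> to \<open>P\<close>, then forgetting the direction of \<open>a \<rightarrow> c\<close>,
  and then that of \<open>b \<rightarrow> c\<close>, leads from \<open>P\<close> to the triangle in three strict steps.

  That nothing lies between in the two covers rests on a necessary condition for \<open>G \<preceq> G'\<close>: each
  DAG of \<open>G\<close> is a subgraph of a DAG of \<open>G'\<close>. It is witnessed by the Dirac law at a schedule in which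
  every vertex depends on each of its parents, as this law lies in the model of a DAG \<open>D'\<close> only if
  \<open>D \<subseteq> D'\<close>.
\<close>

section \<open>Countably separated measurable spaces\<close>

lemma countably_separatedE:
  assumes "countably_separated N"
  obtains C where "countable C" "C \<subseteq> sets N"
    and "\<forall>x\<in>space N. \<forall>y\<in>space N. (\<forall>B\<in>C. x \<in> B \<longleftrightarrow> y \<in> B) \<longrightarrow> x = y"
  using assms unfolding countably_separated_def by metis

text \<open>Distinct points of the product differ in some coordinate, so cylinders over the
  separating sets of that factor tell them apart; finitely many countable families form a countable
  one.\<close>

lemma countably_separated_PiM:
  assumes "finite I" and "\<And>i. i \<in> I \<Longrightarrow> countably_separated (S i)"
  shows "countably_separated (Pi\<^sub>M I S)"
proof -
  have "\<forall>i\<in>I. \<exists>C\<subseteq>sets (S i). countable C \<and>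
      (\<forall>x\<in>space (S i). \<forall>y\<in>space (S i). x \<noteq> y \<longrightarrow> (\<exists>B\<in>C. x \<in> B \<longleftrightarrow> y \<notin> B))"
    using assms(2) unfolding countably_separated_def by blast
  from bchoice[OF this] obtain C where C: "\<forall>i\<in>I. C i \<subseteq> sets (S i) \<and> countable (C i) \<and>
      (\<forall>x\<in>space (S i). \<forall>y\<in>space (S i). x \<noteq> y \<longrightarrow> (\<exists>B\<in>C i. x \<in> B \<longleftrightarrow> y \<notin> B))" ..
  define F where "F = (\<Union>i\<in>I. (\<lambda>B. {f \<in> space (Pi\<^sub>M I S). f i \<in> B}) ` C i)"
  have "countable F"
    unfolding F_def using assms(1) C by (intro countable_UN countable_image) (auto simp: countable_finite)
  moreover have "F \<subseteq> sets (Pi\<^sub>M I S)"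
  proof -
    have "{f \<in> space (Pi\<^sub>M I S). f i \<in> B} \<in> sets (Pi\<^sub>M I S)" if "i \<in> I" "B \<in> C i" for i B
      using that C by (auto intro!: sets_Collect_single)
    then show ?thesis by (auto simp: F_def)
  qed
  moreover have "\<exists>B\<in>F. x \<in> B \<longleftrightarrow> y \<notin> B"
    if xy: "x \<in> space (Pi\<^sub>M I S)" "y \<in> space (Pi\<^sub>M I S)" "x \<noteq> y" for x y
  proof -
    have "\<exists>i\<in>I. x i \<noteq> y i"
    proof (rule ccontr)
      assume "\<not> (\<exists>i\<in>I. x i \<noteq> y i)"
      then have "x = y" using xy(1,2) unfolding space_PiM by (intro PiE_ext[of x I _ y]) auto
      then show False using xy(3) by simp
    qed
    then obtain i where i: "i \<in> I" "x i \<noteq> y i" ..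
    have "x i \<in> space (S i)" "y i \<in> space (S i)"
      using xy i(1) by (auto simp: space_PiM)
    then obtain B where "B \<in> C i" "x i \<in> B \<longleftrightarrow> y i \<notin> B"
      using C i by meson
    then show ?thesis
      using i xy by (intro bexI[of _ "{f \<in> space (Pi\<^sub>M I S). f i \<in> B}"]) (auto simp: F_def)
  qed
  ultimately show ?thesis unfolding countably_separated_def by (intro exI[of _ F]) blast
qed

text \<open>Separation turns the equation into countably many conditions
  \<open>f \<omega> \<in> B \<longleftrightarrow> g \<omega> \<in> B\<close>, each of which is an
  event.\<close>

lemma countably_separated_Collect_eq:
  assumes "countably_separated N" "f \<in> measurable M N" "g \<in> measurable M N"
  shows "{\<omega> \<in> space M. f \<omega> = g \<omega>} \<in> sets M"
proof -
  obtain C where C: "countable C" "C \<subseteq> sets N"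
    and sep: "\<forall>x\<in>space N. \<forall>y\<in>space N. (\<forall>B\<in>C. x \<in> B \<longleftrightarrow> y \<in> B) \<longrightarrow> x = y"
    by (rule countably_separatedE[OF assms(1)])
  have "{\<omega> \<in> space M. f \<omega> = g \<omega>} = {\<omega> \<in> space M. \<forall>B\<in>C. f \<omega> \<in> B \<longleftrightarrow> g \<omega> \<in> B}"
    using sep measurable_space[OF assms(2)] measurable_space[OF assms(3)] by auto
  also have "\<dots> \<in> sets M"
  proof (rule sets.sets_Collect_countable_All'[OF _ C(1)])
    fix B assume "B \<in> C"
    then have [measurable]: "B \<in> sets N" using C(2) by auto
    note [measurable] = assms(2,3)
    show "{\<omega> \<in> space M. f \<omega> \<in> B \<longleftrightarrow> g \<omega> \<in> B} \<in> sets M" by measurable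
  qed
  finally show ?thesis .
qed

lemma countably_separated_singleton:
  assumes "countably_separated N" "y \<in> space N"
  shows "{y} \<in> sets N"
proof -
  have "{x \<in> space N. x = y} \<in> sets N"
    using assms by (intro countably_separated_Collect_eq) auto
  also have "{x \<in> space N. x = y} = {y}" using assms(2) by auto
  finally show ?thesis .
qed

section \<open>Regular conditional distributions\<close>

lemma regular_conditional_distribution_space:
  assumes "regular_conditional_distribution P N Y \<kappa>" "y \<in> space N"
  shows "sets (\<kappa> y) = sets P" "space (\<kappa> y) = space P"
proof -
  have "\<kappa> y \<in> space (prob_algebra P)"
    using assms by (auto simp: regular_conditional_distribution_def dest: measurable_space)
  then show "sets (\<kappa> y) = sets P" by (simp add: space_prob_algebra)
  then show "space (\<kappa> y) = space P" by (rule sets_eq_imp_space_eq)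
qed

text \<open>The defining integral over \<open>C\<close> vanishes, hence so does its nonnegative
  integrand almost everywhere.\<close>

lemma regular_conditional_distribution_null:
  assumes rcd: "regular_conditional_distribution P N Y \<kappa>"
    and B: "B \<in> sets P" and C: "C \<in> sets N"
    and null: "emeasure P (B \<inter> (Y -` C \<inter> space P)) = 0"
  shows "AE y in distr P N Y. y \<in> C \<longrightarrow> emeasure (\<kappa> y) B = 0"
proof -
  have [measurable]: "\<kappa> \<in> measurable N (subprob_algebra P)"
    using rcd by (intro measurable_prob_algebraD) (simp add: regular_conditional_distribution_def)
  note [measurable] = B C
  have "(\<integral>\<^sup>+y. emeasure (\<kappa> y) B * indicator C y \<partial>distr P N Y) = 0"
    using rcd[unfolded regular_conditional_distribution_def, THEN conjunct2, rule_format, OF B C] null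
    by simp
  then have "AE y in distr P N Y. emeasure (\<kappa> y) B * indicator C y = 0"
    by (subst (asm) nn_integral_0_iff_AE) simp_all
  then show ?thesis by eventually_elim (auto simp: indicator_def split: if_splits)
qed

text \<open>For one set \<open>C\<close> the reason is that \<open>Y \<in> C\<close> and
  \<open>Y \<notin> C\<close> exclude each other. A countable separating family then yields one
  exceptional null set for all \<open>C\<close> together, and membership in all its sets pins
  \<open>Y\<close> down to \<open>y\<close>.\<close>

lemma regular_conditional_distribution_AE_eq:
  assumes rcd: "regular_conditional_distribution P N Y \<kappa>"
    and Y [measurable]: "Y \<in> measurable P N" and sepN: "countably_separated N"
  shows "AE y in distr P N Y. AE \<omega> in \<kappa> y. Y \<omega> = y"
proof -
  obtain \<C> where \<C>: "countable \<C>" "\<C> \<subseteq> sets N"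
    and sep: "\<forall>x\<in>space N. \<forall>y\<in>space N. (\<forall>B\<in>\<C>. x \<in> B \<longleftrightarrow> y \<in> B) \<longrightarrow> x = y"
    by (rule countably_separatedE[OF sepN])
  have one: "AE y in distr P N Y. y \<in> C \<longrightarrow> (AE \<omega> in \<kappa> y. Y \<omega> \<in> C)" if C: "C \<in> sets N" for C
  proof -
    have "AE y in distr P N Y. y \<in> C \<longrightarrow> emeasure (\<kappa> y) (space P - Y -` C \<inter> space P) = 0"
    proof (rule regular_conditional_distribution_null[OF rcd])
      show "space P - Y -` C \<inter> space P \<in> sets P" using C by measurable
      have "(space P - Y -` C \<inter> space P) \<inter> (Y -` C \<inter> space P) = {}" by auto
      then show "emeasure P ((space P - Y -` C \<inter> space P) \<inter> (Y -` C \<inter> space P)) = 0" by simp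
    qed (fact C)
    then show ?thesis
    proof (rule AE_mp[OF _ AE_I2], intro impI)
      fix y assume y: "y \<in> space (distr P N Y)" "y \<in> C"
        and z: "y \<in> C \<longrightarrow> emeasure (\<kappa> y) (space P - Y -` C \<inter> space P) = 0"
      note sp = regular_conditional_distribution_space[OF rcd, of y]
      show "AE \<omega> in \<kappa> y. Y \<omega> \<in> C"
      proof (rule AE_I)
        show "{\<omega> \<in> space (\<kappa> y). \<not> Y \<omega> \<in> C} \<subseteq> space P - Y -` C \<inter> space P" using sp y by auto
        show "space P - Y -` C \<inter> space P \<in> sets (\<kappa> y)" using sp y C by simp
      qed (use z y in simp)
    qed
  qed
  \<comment> \<open>The complements are included because \<open>y \<notin> C\<close> has to carry
    over to \<open>Y\<close> as well.\<close>
  have "AE y in distr P N Y. \<forall>C\<in>\<C>. (y \<in> C \<longrightarrow> (AE \<omega> in \<kappa> y. Y \<omega> \<in> C)) \<and>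
      (y \<in> space N - C \<longrightarrow> (AE \<omega> in \<kappa> y. Y \<omega> \<in> space N - C))"
    unfolding AE_ball_countable[OF \<C>(1)] using \<C>(2) by (intro ballI AE_conjI one) auto
  then show ?thesis
  proof (rule AE_mp[OF _ AE_I2], intro impI)
    fix y assume "y \<in> space (distr P N Y)"
      and *: "\<forall>C\<in>\<C>. (y \<in> C \<longrightarrow> (AE \<omega> in \<kappa> y. Y \<omega> \<in> C)) \<and>
        (y \<in> space N - C \<longrightarrow> (AE \<omega> in \<kappa> y. Y \<omega> \<in> space N - C))"
    then have y: "y \<in> space N" by simp
    have "AE \<omega> in \<kappa> y. \<forall>C\<in>\<C>. Y \<omega> \<in> C \<longleftrightarrow> y \<in> C"
      unfolding AE_ball_countable[OF \<C>(1)]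
    proof
      fix C assume C: "C \<in> \<C>"
      show "AE \<omega> in \<kappa> y. Y \<omega> \<in> C \<longleftrightarrow> y \<in> C"
      proof (cases "y \<in> C")
        case True
        then have "AE \<omega> in \<kappa> y. Y \<omega> \<in> C" using * C by blast
        then show ?thesis by eventually_elim (use True in simp)
      next
        case False
        then have "AE \<omega> in \<kappa> y. Y \<omega> \<in> space N - C" using * C y by blast
        then show ?thesis by eventually_elim (use False in simp)
      qed
    qed
    then show "AE \<omega> in \<kappa> y. Y \<omega> = y"
    proof (rule AE_mp[OF _ AE_I2], intro impI)
      fix \<omega> assume "\<omega> \<in> space (\<kappa> y)" "\<forall>C\<in>\<C>. Y \<omega> \<in> C \<longleftrightarrow> y \<in> C"
      then show "Y \<omega> = y"
        using sep y measurable_space[OF Y] regular_conditional_distribution_space[OF rcd y]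
        by blast
    qed
  qed
qed

text \<open>Law of total probability: the probability of the exceptional event is the integral of
  its conditional probabilities, almost all of which are zero.\<close>

lemma regular_conditional_distribution_AE:
  assumes rcd: "regular_conditional_distribution P N Y \<kappa>" and Y: "Y \<in> measurable P N"
    and Q: "{\<omega> \<in> space P. Q \<omega>} \<in> sets P" and AE: "AE y in distr P N Y. AE \<omega> in \<kappa> y. Q \<omega>"
  shows "AE \<omega> in P. Q \<omega>"
proof -
  let ?B = "{\<omega> \<in> space P. \<not> Q \<omega>}"
  have B: "?B \<in> sets P" using Q by (rule sets.sets_Collect_neg)
  have "emeasure P ?B = emeasure P (?B \<inter> (Y -` space N \<inter> space P))"
    using measurable_space[OF Y] by (intro arg_cong[where f = "emeasure P"]) auto
  also have "\<dots> = (\<integral>\<^sup>+y\<in>space N. emeasure (\<kappa> y) ?B \<partial>distr P N Y)"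
    using rcd B unfolding regular_conditional_distribution_def by blast
  also have "\<dots> = (\<integral>\<^sup>+y. 0 \<partial>distr P N Y)"
  proof (rule nn_integral_cong_AE, use AE in \<open>rule AE_mp[OF _ AE_I2]\<close>, intro impI)
    fix y assume y: "y \<in> space (distr P N Y)" and Qy: "AE \<omega> in \<kappa> y. Q \<omega>"
    note sp = regular_conditional_distribution_space[OF rcd, of y]
    have "emeasure (\<kappa> y) {\<omega> \<in> space (\<kappa> y). \<not> Q \<omega>} = 0"
      using Qy B sp y by (subst (asm) AE_iff_measurable[OF _ refl]) auto
    then show "emeasure (\<kappa> y) ?B * indicator (space N) y = 0" using sp y by simp
  qed
  finally have "emeasure P ?B = 0" by simp
  then show ?thesis using B by (subst AE_iff_measurable[OF _ refl]) auto
qed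

text \<open>Independence says that the joint law is the product of the marginal laws, and neither
  side sees changes on null sets.\<close>

lemma (in prob_space) indep_vars_cong_AE:
  assumes "indep_vars N X I" and AE: "\<And>i. i \<in> I \<Longrightarrow> AE \<omega> in M. X i \<omega> = Y i \<omega>"
    and Y: "\<And>i. i \<in> I \<Longrightarrow> random_variable (N i) (Y i)" and "finite I"
  shows "indep_vars N Y I"
\<comment> \<open>The characterisation by product measures is available for nonempty index sets
  only.\<close>
proof (cases "I = {}")
  case True
  then show ?thesis by (simp add: indep_vars_def2 indep_sets_def)
next
  case False
  have X: "\<And>i. i \<in> I \<Longrightarrow> random_variable (N i) (X i)"
    using assms(1) by (simp add: indep_vars_def2)
  have "distr M (\<Pi>\<^sub>M i\<in>I. N i) (\<lambda>x. \<lambda>i\<in>I. Y i x) = distr M (\<Pi>\<^sub>M i\<in>I. N i) (\<lambda>x. \<lambda>i\<in>I. X i x)"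
  proof (rule distr_cong_AE)
    have "AE \<omega> in M. \<forall>i\<in>I. X i \<omega> = Y i \<omega>" using AE \<open>finite I\<close> by (intro AE_finite_allI)
    then show "AE \<omega> in M. (\<lambda>i\<in>I. Y i \<omega>) = (\<lambda>i\<in>I. X i \<omega>)"
      by eventually_elim (auto intro!: restrict_ext)
  qed (auto intro!: measurable_restrict X Y)
  also have "\<dots> = (\<Pi>\<^sub>M i\<in>I. distr M (N i) (X i))"
    using assms(1) indep_vars_iff_distr_eq_PiM'[OF False X] by simp
  also have "\<dots> = (\<Pi>\<^sub>M i\<in>I. distr M (N i) (Y i))"
    using AE X Y by (intro PiM_cong distr_cong_AE) auto
  finally show ?thesis using indep_vars_iff_distr_eq_PiM'[OF False Y] by simp
qed

section \<open>Laws concentrated at one point\<close>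

lemma AE_return_iff:
  assumes "x \<in> space M" "{y \<in> space M. Q y} \<in> sets M"
  shows "(AE y in return M x. Q y) \<longleftrightarrow> Q x"
  using AE_return[OF assms(1), of Q] assms(2) by (simp add: pred_def)

text \<open>Probabilities under a point mass are indicators, and the indicator of an intersection is
  the product of the indicators.\<close>

lemma indep_vars_return:
  assumes "x \<in> space M" and X: "\<And>i. i \<in> I \<Longrightarrow> X i \<in> measurable M (N i)"
  shows "prob_space.indep_vars (return M x) N X I"
proof -
  interpret prob_space "return M x" using assms(1) by (rule prob_space_return)
  show ?thesis unfolding indep_vars_def2
  proof (intro conjI ballI indep_setsI)
    fix i assume "i \<in> I"
    then show "random_variable (N i) (X i)" using X by simp
    show "{X i -` B \<inter> space (return M x) |B. B \<in> sets (N i)} \<subseteq> events"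
      using X[OF \<open>i \<in> I\<close>] by auto
  next
    fix B J assume J: "J \<noteq> {}" "J \<subseteq> I" "finite J"
      and "\<forall>j\<in>J. B j \<in> {X j -` B \<inter> space (return M x) |B. B \<in> sets (N j)}"
    then have B: "B j \<in> sets M" if "j \<in> J" for j using that X by fastforce
    have "prob (\<Inter>j\<in>J. B j) = indicator (\<Inter>j\<in>J. B j) x"
      using B J by (intro measure_return sets.finite_INT) auto
    also have "\<dots> = (\<Prod>j\<in>J. indicator (B j) x)"
      using J(3) by (induction J) (auto simp: indicator_def)
    also have "\<dots> = (\<Prod>j\<in>J. prob (B j))" using B by (simp add: measure_return)
    finally show "prob (\<Inter>j\<in>J. B j) = (\<Prod>j\<in>J. prob (B j))" .
  qed
qed

text \<open>The law of \<open>Y\<close> is the point mass at \<open>Y x\<close>, so the kernel is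
  prescribed only there and \<open>\<mu>\<close> can fill in all other values. Measurability of
  \<open>{Y x}\<close> makes the case distinction measurable.\<close>

lemma regular_conditional_distribution_return:
  assumes x: "x \<in> space M" and Y [measurable]: "Y \<in> measurable M N" and sing: "{Y x} \<in> sets N"
    and \<mu>: "prob_space \<mu>" "sets \<mu> = sets M"
  shows "regular_conditional_distribution (return M x) N Y (\<lambda>y. if y = Y x then return M x else \<mu>)"
    (is "regular_conditional_distribution _ _ _ ?\<kappa>")
proof -
  have mem: "return M x \<in> space (prob_algebra (return M x))" "\<mu> \<in> space (prob_algebra (return M x))"
    using \<mu> prob_space_return[OF x] by (auto simp: space_prob_algebra)
  have \<kappa>: "?\<kappa> \<in> measurable N (prob_algebra (return M x))"
  proof (rule measurable_If)
    have "{y \<in> space N. y = Y x} = {Y x}" using measurable_space[OF Y x] by auto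
    then show "{y \<in> space N. y = Y x} \<in> sets N" using sing by simp
  qed (auto intro: measurable_const mem)
  have "emeasure (return M x) (B \<inter> (Y -` C \<inter> space (return M x)))
      = (\<integral>\<^sup>+y\<in>C. emeasure (?\<kappa> y) B \<partial>distr (return M x) N Y)"
    if B: "B \<in> sets (return M x)" and C [measurable]: "C \<in> sets N" for B C
  proof -
    have [measurable]: "?\<kappa> \<in> measurable N (subprob_algebra (return M x))"
      using \<kappa> by (rule measurable_prob_algebraD)
    note [measurable] = B
    have "(\<integral>\<^sup>+y\<in>C. emeasure (?\<kappa> y) B \<partial>distr (return M x) N Y)
        = (\<integral>\<^sup>+y\<in>C. emeasure (?\<kappa> y) B \<partial>return N (Y x))"
      by (subst distr_return[OF Y x]) simp
    also have "\<dots> = emeasure (?\<kappa> (Y x)) B * indicator C (Y x)"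
      using measurable_space[OF Y x] by (intro nn_integral_return) measurable
    also have "\<dots> = emeasure (return M x) (B \<inter> (Y -` C \<inter> space (return M x)))"
      using B x by (subst emeasure_return) (auto simp: indicator_def)
    finally show ?thesis by simp
  qed
  then show ?thesis using \<kappa> by (simp add: regular_conditional_distribution_def)
qed

section \<open>Potential outcome schedules\<close>

lemma setting_apply: "setting x I v = (if v \<in> I then Some (x v) else None)"
  by (simp add: setting_def)

lemma setting_cong: "(\<And>v. v \<in> I \<Longrightarrow> x v = y v) \<Longrightarrow> setting x I = setting y I"
  by (auto simp: setting_def)

lemma setting_empty [simp]: "setting x {} = Map.empty"
  by (simp add: setting_def)

lemma outcomes_apply: "v \<in> J \<Longrightarrow> outcomes J m \<omega> v = \<omega> (v, m)"
  by (simp add: outcomes_def)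

lemma interventions_iff:
  "m \<in> interventions V S \<longleftrightarrow> (\<forall>v y. m v = Some y \<longrightarrow> v \<in> V \<and> y \<in> space (S v))"
proof
  assume "m \<in> interventions V S"
  then show "\<forall>v y. m v = Some y \<longrightarrow> v \<in> V \<and> y \<in> space (S v)"
    by (auto simp: interventions_def setting_apply space_PiM split: if_splits)
next
  assume *: "\<forall>v y. m v = Some y \<longrightarrow> v \<in> V \<and> y \<in> space (S v)"
  define x where "x = (\<lambda>v\<in>dom m. the (m v))"
  have "m = setting x (dom m)"
    by (auto simp: setting_def x_def fun_eq_iff)
  moreover have "dom m \<subseteq> V" "x \<in> space (Pi\<^sub>M (dom m) S)"
    using * by (auto simp: space_PiM x_def)
  ultimately show "m \<in> interventions V S" unfolding interventions_def by blast
qed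

lemma setting_interventions:
  assumes "x \<in> space (Pi\<^sub>M I S)" "J \<subseteq> I" "I \<subseteq> V"
  shows "setting x J \<in> interventions V S"
  using assms by (auto simp: interventions_iff setting_apply space_PiM split: if_splits)

lemma map_add_interventions:
  assumes "m \<in> interventions V S" "m' \<in> interventions V S"
  shows "m ++ m' \<in> interventions V S"
  using assms by (auto simp: interventions_iff map_add_Some_iff)

section \<open>Measurability and consistency over a fixed space of schedules\<close>

locale schedule_space =
  fixes V :: "'v set"
    and S :: "'v \<Rightarrow> 'x measure"
    and A :: "('v, 'x) schedule measure"
  assumes finite_V: "finite V"
    and state_spaces: "state_spaces V S"
    and suitable: "suitable_schedule_space V S A"
begin

lemma space_A: "space A = schedules V S"
  using suitable by (simp add: suitable_schedule_space_def)

lemma measurable_outcome: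
  assumes "v \<in> V" "I \<subseteq> V" "J \<subseteq> I" "K \<subseteq> V - I" "x \<in> space (Pi\<^sub>M V S)"
  shows "(\<lambda>\<omega>. \<omega> (v, setting x J ++ setting (outcomes K (setting x I) \<omega>) K)) \<in> measurable A (S v)"
  using suitable assms unfolding suitable_schedule_space_def by blast

lemma state_space_two_points:
  assumes "v \<in> V" obtains x y where "x \<in> space (S v)" "y \<in> space (S v)" "x \<noteq> y"
proof -
  have "infinite (space (S v)) \<or> card (space (S v)) \<ge> 2"
    using state_spaces assms by (simp add: state_spaces_def)
  then have "\<not> (\<exists>x. space (S v) \<subseteq> {x})"
    by (metis card_1_singleton_iff card.empty finite.emptyI finite_insert finite_subset
        not_numeral_le_zero one_le_numeral numeral_le_one_iff semiring_norm(69) subset_singletonD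
        One_nat_def)
  then show thesis using that by blast
qed

lemma measurable_coordinate:
  assumes "v \<in> V" "m \<in> interventions V S"
  shows "(\<lambda>\<omega>. \<omega> (v, m)) \<in> measurable A (S v)"
proof -
  have "\<exists>y. y \<in> space (S u)" if "u \<in> V" for u
    using state_space_two_points[OF that] by blast
  then obtain t where t: "\<And>u. u \<in> V \<Longrightarrow> t u \<in> space (S u)" by metis
  \<comment> \<open>Suitability speaks of settings taken from points of the full product, so
    \<open>m\<close> is extended by arbitrary admissible values \<open>t\<close>.\<close>
  define x where "x = (\<lambda>u\<in>V. case m u of None \<Rightarrow> t u | Some y \<Rightarrow> y)"
  have "dom m \<subseteq> V" and x: "x \<in> space (Pi\<^sub>M V S)"
    using assms(2) t by (auto simp: interventions_iff x_def space_PiM split: option.splits)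
  moreover have "m = setting x (dom m)"
    using \<open>dom m \<subseteq> V\<close> by (auto simp: setting_def x_def fun_eq_iff domIff split: option.splits)
  ultimately show ?thesis
    using measurable_outcome[OF assms(1), of "dom m" "dom m" "{}" x] by simp
qed

lemma measurable_outcomes:
  assumes "J \<subseteq> V" "m \<in> interventions V S"
  shows "outcomes J m \<in> measurable A (Pi\<^sub>M J S)"
  unfolding outcomes_def using assms by (intro measurable_restrict measurable_coordinate) auto

lemma countably_separated_states: "I \<subseteq> V \<Longrightarrow> countably_separated (Pi\<^sub>M I S)"
  using state_spaces finite_V
  by (intro countably_separated_PiM) (auto simp: state_spaces_def dest: finite_subset)

text \<open>Consistency evaluated at the random value of the conditioning variable. Under the
  conditional law at \<open>y\<close> this value is almost surely \<open>y\<close>, so the statement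
  for fixed values applies, and integrating over \<open>y\<close> removes the conditioning.\<close>

lemma consistent_AE:
  assumes P: "P \<in> causal_model V S A" and I: "I \<subseteq> V" "I' \<subseteq> V" "I \<inter> I' = {}"
    and x: "x \<in> space (Pi\<^sub>M V S)" and v: "v \<in> V"
  shows "AE \<omega> in P. \<omega> (v, setting x I ++ setting (outcomes I' (setting x I) \<omega>) I')
    = \<omega> (v, setting x I)"
proof -
  let ?Y = "outcomes I' (setting x I)" and ?N = "Pi\<^sub>M I' S"
  have sets: "sets P = sets A" and space: "space P = space A"
    using P sets_eq_imp_space_eq[of P A] by (auto simp: causal_model_def)
  have m: "setting x I \<in> interventions V S" using x I(1) subset_refl by (rule setting_interventions)
  have Y: "?Y \<in> measurable P ?N"
    using measurable_outcomes[OF I(2) m] by (simp add: measurable_cong_sets[OF sets refl])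
  \<comment> \<open>Consistency quantifies over points of the product over \<open>I\<close>, hence
    the restriction.\<close>
  have a: "restrict x I \<in> space (Pi\<^sub>M I S)" "setting (restrict x I) I = setting x I"
    using x I by (auto simp: space_PiM PiE_iff intro!: setting_cong)
  obtain \<kappa> where rcd: "regular_conditional_distribution P ?N ?Y \<kappa>"
    and \<kappa>: "\<And>b. b \<in> space ?N \<Longrightarrow> AE \<omega> in \<kappa> b.
      outcomes V (setting x I ++ setting b I') \<omega> = outcomes V (setting x I) \<omega>"
  proof -
    have "consistent V S P" using P by (simp add: causal_model_def)
    from this[unfolded consistent_def, rule_format, OF I a(1)] show thesis
      using that unfolding a(2) by blast
  qed
  show ?thesis
  proof (rule regular_conditional_distribution_AE[OF rcd Y])
    have "{\<omega> \<in> space A. \<omega> (v, setting x I ++ setting (?Y \<omega>) I') = \<omega> (v, setting x I)} \<in> sets A"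
    proof (rule countably_separated_Collect_eq)
      show "countably_separated (S v)" using state_spaces v by (simp add: state_spaces_def)
      show "(\<lambda>\<omega>. \<omega> (v, setting x I ++ setting (?Y \<omega>) I')) \<in> measurable A (S v)"
        using I x v by (intro measurable_outcome) auto
    qed (use v m in \<open>rule measurable_coordinate\<close>)
    then show "{\<omega> \<in> space P. \<omega> (v, setting x I ++ setting (?Y \<omega>) I') = \<omega> (v, setting x I)} \<in> sets P"
      by (simp add: sets space)
    have "AE y in distr P ?N ?Y. AE \<omega> in \<kappa> y. ?Y \<omega> = y"
      using rcd Y countably_separated_states[OF I(2)] by (rule regular_conditional_distribution_AE_eq)
    then show "AE y in distr P ?N ?Y. AE \<omega> in \<kappa> y.
        \<omega> (v, setting x I ++ setting (?Y \<omega>) I') = \<omega> (v, setting x I)"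
    proof (rule AE_mp[OF _ AE_I2], intro impI)
      fix y assume y: "y \<in> space (distr P ?N ?Y)" and Y_eq: "AE \<omega> in \<kappa> y. ?Y \<omega> = y"
      have "AE \<omega> in \<kappa> y.
          outcomes V (setting x I ++ setting y I') \<omega> = outcomes V (setting x I) \<omega>"
        using \<kappa> y by simp
      with Y_eq show "AE \<omega> in \<kappa> y. \<omega> (v, setting x I ++ setting (?Y \<omega>) I') = \<omega> (v, setting x I)"
      proof eventually_elim
        case (elim \<omega>)
        then show ?case using v by (metis outcomes_apply)
      qed
    qed
  qed
qed

section \<open>Adding all edges into a vertex\<close>

text \<open>
  For uncountable state spaces, inclusion of DAGs need not imply inclusion of their models: the
  exceptional null sets depend on the intervened values, whereas the definition of the model
  evaluates potential outcomes at random values. Consistency yields the inclusion when all edges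
  live on the vertex \<open>v\<close> and its new parents \<open>W\<close>, because then interventions outside \<open>W\<close> affect
  neither \<open>v\<close> nor \<open>W\<close>.
\<close>

lemma dag_modelD:
  assumes "P \<in> dag_model V S A D"
  shows "P \<in> causal_model V S A"
    and "\<And>v I x. v \<in> V \<Longrightarrow> I \<subseteq> V \<Longrightarrow> x \<in> space (Pi\<^sub>M V S) \<Longrightarrow> AE \<omega> in P.
      \<omega> (v, setting x I) = \<omega> (v, setting x (parents D v \<inter> I) ++
        setting (outcomes (parents D v - I) (setting x I) \<omega>) (parents D v - I))"
    and "\<And>x. x \<in> space (Pi\<^sub>M V S) \<Longrightarrow>
      prob_space.indep_vars P S (\<lambda>v \<omega>. \<omega> (v, setting x (parents D v))) V"
  using assms by (auto simp: dag_model_def)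

text \<open>Induction along the edges. Recursive substitution expresses both sides through the same
  imposed parents and through the outcomes of the parents outside \<open>I\<close>, which agree
  almost surely by induction, because these parents lie in \<open>W\<close> and thus in
  \<open>U\<close>.\<close>

lemma dag_model_local:
  assumes P: "P \<in> dag_model V S A D" and D: "D \<in> dags V"
    and W: "W \<subseteq> V" "\<And>p. p \<in> U \<Longrightarrow> parents D p \<subseteq> W" "W \<subseteq> U" "U \<subseteq> V"
    and I: "I \<subseteq> V" and x: "x \<in> space (Pi\<^sub>M V S)" and u: "u \<in> U"
  shows "AE \<omega> in P. \<omega> (u, setting x I) = \<omega> (u, setting x (W \<inter> I))"
proof -
  have DV: "D \<subseteq> V \<times> V" and "acyclic D" using D by (auto simp: dags_def)
  then have "wf D" using finite_V by (meson finite_SigmaI finite_acyclic_wf finite_subset)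
  then show ?thesis using u
  proof (induction u rule: wf_induct_rule)
    case (less u)
    then have u: "u \<in> V" using W(4) by auto
    let ?Q = "parents D u"
    have Q: "?Q \<subseteq> W" using W(2) less.prems by blast
    then have eq: "?Q \<inter> (W \<inter> I) = ?Q \<inter> I" "?Q - W \<inter> I = ?Q - I" by auto
    have "AE \<omega> in P. \<forall>p\<in>?Q - I. \<omega> (p, setting x I) = \<omega> (p, setting x (W \<inter> I))"
    proof (rule AE_finite_allI)
      show "finite (?Q - I)" using Q W finite_V by (meson finite_Diff finite_subset)
      show "AE \<omega> in P. \<omega> (p, setting x I) = \<omega> (p, setting x (W \<inter> I))" if "p \<in> ?Q - I" for p
        using that Q W(3) less.IH[of p] by (auto simp: parents_def)
    qed
    moreover have "AE \<omega> in P. \<omega> (u, setting x I) = \<omega> (u, setting x (?Q \<inter> I) ++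
        setting (outcomes (?Q - I) (setting x I) \<omega>) (?Q - I))"
      using dag_modelD(2)[OF P u I x] .
    moreover have "AE \<omega> in P. \<omega> (u, setting x (W \<inter> I)) = \<omega> (u, setting x (?Q \<inter> I) ++
        setting (outcomes (?Q - I) (setting x (W \<inter> I)) \<omega>) (?Q - I))"
      using dag_modelD(2)[OF P u _ x, of "W \<inter> I"] I unfolding eq by blast
    ultimately show ?case
    proof eventually_elim
      case (elim \<omega>)
      have "setting (outcomes (?Q - I) (setting x I) \<omega>) (?Q - I)
          = setting (outcomes (?Q - I) (setting x (W \<inter> I)) \<omega>) (?Q - I)"
        using elim(1) by (intro setting_cong) (simp add: outcomes_apply)
      then show ?case using elim(2,3) by simp
    qed
  qed
qed

text \<open>Only \<open>v\<close> changes its parents. Locality reduces \<open>I\<close> to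
  \<open>W \<inter> I\<close>; consistency for \<open>W \<inter> I\<close> and \<open>W - I\<close>
  then imposes on \<open>W - I\<close> the values that it takes anyway, and locality turns these
  back into the values under \<open>I\<close>.\<close>

lemma dag_model_add_parents:
  assumes D: "D \<in> dags V" and v: "v \<in> V" and W: "W \<subseteq> V"
    and D_sub: "D \<subseteq> insert v W \<times> insert v W" and D': "D \<union> W \<times> {v} \<in> dags V"
  shows "dag_model V S A D \<subseteq> dag_model V S A (D \<union> W \<times> {v})"
proof
  fix P assume P: "P \<in> dag_model V S A D"
  let ?D' = "D \<union> W \<times> {v}"
  have acyc: "acyclic ?D'" using D' by (simp add: dags_def)
  \<comment> \<open>Such an edge would close a cycle with the new edge from \<open>p\<close> to
    \<open>v\<close>, or be a loop if \<open>p = v\<close>.\<close>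
  have no_child: "(v, p) \<notin> D" if "p \<in> insert v W" for p
  proof
    assume "(v, p) \<in> D"
    then have "(v, p) \<in> ?D'\<^sup>+" by auto
    moreover have "(p, v) \<in> ?D'\<^sup>*" using that by auto
    ultimately have "(v, v) \<in> ?D'\<^sup>+" by (rule trancl_rtrancl_trancl)
    then show False using acyc by (auto simp: acyclic_def)
  qed
  have par: "parents D p \<subseteq> W" if "p \<in> insert v W" for p
    using D_sub no_child[OF that] by (auto simp: parents_def)
  have par_v: "parents ?D' v = W" using par by (auto simp: parents_def)
  have par_u: "parents ?D' u = parents D u" if "u \<noteq> v" for u using that by (auto simp: parents_def)
  have local: "AE \<omega> in P. \<omega> (u, setting x I) = \<omega> (u, setting x (W \<inter> I))"
    if "u \<in> insert v W" "I \<subseteq> V" "x \<in> space (Pi\<^sub>M V S)" for u I x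
    using dag_model_local[OF P D W par _ _ that(2,3,1)] W v by auto
  show "P \<in> dag_model V S A ?D'"
    unfolding dag_model_def
  proof (intro CollectI conjI ballI allI impI)
    show "P \<in> causal_model V S A" using dag_modelD(1)[OF P] .
  next
    fix u I x assume u: "u \<in> V" and I: "I \<subseteq> V" and x: "x \<in> space (Pi\<^sub>M V S)"
    show "AE \<omega> in P. \<omega> (u, setting x I) = \<omega> (u, setting x (parents ?D' u \<inter> I) ++
        setting (outcomes (parents ?D' u - I) (setting x I) \<omega>) (parents ?D' u - I))"
    proof (cases "u = v")
      case False
      then show ?thesis using dag_modelD(2)[OF P u I x] par_u by simp
    next
      case True
      have "AE \<omega> in P. \<forall>p\<in>W - I. \<omega> (p, setting x I) = \<omega> (p, setting x (W \<inter> I))"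
        using W finite_V I x by (intro AE_finite_allI local) (auto dest: finite_subset)
      moreover have "AE \<omega> in P. \<omega> (v, setting x I) = \<omega> (v, setting x (W \<inter> I))"
        using I x by (intro local) auto
      moreover have "AE \<omega> in P. \<omega> (v, setting x (W \<inter> I) ++
          setting (outcomes (W - I) (setting x (W \<inter> I)) \<omega>) (W - I)) = \<omega> (v, setting x (W \<inter> I))"
        using W x v by (intro consistent_AE[OF dag_modelD(1)[OF P]]) auto
      ultimately show ?thesis unfolding True par_v
      proof eventually_elim
        case (elim \<omega>)
        have "setting (outcomes (W - I) (setting x I) \<omega>) (W - I)
            = setting (outcomes (W - I) (setting x (W \<inter> I)) \<omega>) (W - I)"
          using elim(1) by (intro setting_cong) (simp add: outcomes_apply)
        then show ?case using elim(2,3) by simp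
      qed
    qed
  next
    fix x assume x: "x \<in> space (Pi\<^sub>M V S)"
    have P_prob: "prob_space P" and sets: "sets P = sets A"
      using dag_modelD(1)[OF P] by (auto simp: causal_model_def)
    have par_V: "parents ?D' u \<subseteq> V" for u using D' by (auto simp: parents_def dags_def)
    show "prob_space.indep_vars P S (\<lambda>u \<omega>. \<omega> (u, setting x (parents ?D' u))) V"
    proof (rule prob_space.indep_vars_cong_AE[OF P_prob dag_modelD(3)[OF P x]])
      fix u assume u: "u \<in> V"
      show "AE \<omega> in P. \<omega> (u, setting x (parents D u)) = \<omega> (u, setting x (parents ?D' u))"
      proof (cases "u = v")
        case True
        \<comment> \<open>With \<open>I = W\<close> all old parents of \<open>v\<close> are imposed,
          so no random outcome is substituted.\<close>
        have "parents D v \<inter> W = parents D v" "parents D v - W = {}" using par[of v] by auto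
        then have "AE \<omega> in P. \<omega> (v, setting x W) = \<omega> (v, setting x (parents D v))"
          using dag_modelD(2)[OF P v W x] by (simp only: setting_empty map_add_empty)
        then show ?thesis unfolding True par_v by eventually_elim simp
      qed (simp add: par_u)
      show "(\<lambda>\<omega>. \<omega> (u, setting x (parents ?D' u))) \<in> measurable P (S u)"
        unfolding measurable_cong_sets[OF sets refl]
        using u par_V x by (intro measurable_coordinate setting_interventions[OF x]) auto
    qed (rule finite_V)
  qed
qed

end

section \<open>Deterministic schedules\<close>

text \<open>
  The structural equations send \<open>v\<close> to \<open>s v\<close> if all its parents \<open>p\<close> have the value \<open>s p\<close>, and to
  another value \<open>t v\<close> otherwise. The predicate says when the latter happens under the
  intervention \<open>m\<close>.
\<close>

inductive deviates :: "'v digraph \<Rightarrow> ('v \<Rightarrow> 'x) \<Rightarrow> ('v \<rightharpoonup> 'x) \<Rightarrow> 'v \<Rightarrow> bool" for D s m where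
  imposed: "(p, v) \<in> D \<Longrightarrow> m p = Some y \<Longrightarrow> y \<noteq> s p \<Longrightarrow> deviates D s m v"
| inherited: "(p, v) \<in> D \<Longrightarrow> m p = None \<Longrightarrow> deviates D s m p \<Longrightarrow> deviates D s m v"

definition conj_schedule ::
    "'v set \<Rightarrow> ('v \<Rightarrow> 'x measure) \<Rightarrow> 'v digraph \<Rightarrow> ('v \<Rightarrow> 'x) \<Rightarrow> ('v \<Rightarrow> 'x) \<Rightarrow> ('v, 'x) schedule" where
  "conj_schedule V S D s t =
     (\<lambda>(v, m)\<in>V \<times> interventions V S. if deviates D s m v then t v else s v)"

text \<open>Prepares recursive substitution: \<open>m'\<close> imposes on every parent of
  \<open>v\<close> the value that it has under \<open>m\<close>, up to the distinction between
  \<open>s p\<close> and other values, which is all that the equation of \<open>v\<close>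
  sees.\<close>

lemma deviates_parents:
  assumes dom: "\<And>p. (p, v) \<in> D \<Longrightarrow> m' p \<noteq> None"
    and imp: "\<And>p y. (p, v) \<in> D \<Longrightarrow> m p = Some y \<Longrightarrow> m' p = Some y"
    and inh: "\<And>p. (p, v) \<in> D \<Longrightarrow> m p = None \<Longrightarrow> m' p \<noteq> Some (s p) \<longleftrightarrow> deviates D s m p"
  shows "deviates D s m' v \<longleftrightarrow> deviates D s m v"
proof
  assume "deviates D s m' v"
  then have "\<exists>p y. (p, v) \<in> D \<and> m' p = Some y \<and> y \<noteq> s p"
    by cases (use dom in blast)+
  then obtain p y where "(p, v) \<in> D" "m' p = Some y" "y \<noteq> s p" by blast
  then show "deviates D s m v"
    using imp[of p] inh[of p] by (cases "m p") (auto intro: deviates.intros)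
next
  assume "deviates D s m v"
  then show "deviates D s m' v"
  proof cases
    case (imposed p y)
    then show ?thesis using imp by (blast intro: deviates.imposed)
  next
    case (inherited p)
    then obtain y where "m' p = Some y" "y \<noteq> s p" using dom[of p] inh[of p] by auto
    then show ?thesis using inherited(1) by (blast intro: deviates.imposed)
  qed
qed

text \<open>Prepares consistency: \<open>n\<close> imposes values in agreement with what happens
  under \<open>m\<close>. A deviation imposed by \<open>n\<close> is an inherited one under
  \<open>m\<close> and conversely, so derivations translate rule by rule.\<close>

lemma deviates_consistent:
  assumes disj: "\<And>p. m p \<noteq> None \<Longrightarrow> n p = None"
    and n: "\<And>p y. n p = Some y \<Longrightarrow> y \<noteq> s p \<longleftrightarrow> deviates D s m p"
  shows "deviates D s (m ++ n) v \<longleftrightarrow> deviates D s m v"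
proof
  assume "deviates D s (m ++ n) v"
  then show "deviates D s m v"
  proof induction
    case (imposed p v y)
    show ?case
    proof (cases "n p")
      case None
      then show ?thesis using imposed by (intro deviates.imposed[of p _ _ _ y]) auto
    next
      case (Some z)
      then have "m p = None" using disj[of p] by (cases "m p") auto
      moreover have "deviates D s m p" using n[OF Some] Some imposed by simp
      ultimately show ?thesis using imposed(1) by (blast intro: deviates.inherited)
    qed
  next
    case (inherited p v)
    then show ?case by (auto intro: deviates.inherited)
  qed
next
  assume "deviates D s m v"
  then show "deviates D s (m ++ n) v"
  proof induction
    case (imposed p v y)
    then have "(m ++ n) p = Some y" using disj[of p] by (auto simp: map_add_Some_iff)
    with imposed(1) show ?case using imposed(3) by (rule deviates.imposed)
  next
    case (inherited p v)
    show ?case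
    proof (cases "n p")
      case None
      then have "(m ++ n) p = None" using inherited by simp
      with inherited(1) show ?thesis using inherited(4) by (rule deviates.inherited)
    next
      case (Some y)
      then have "(m ++ n) p = Some y" "y \<noteq> s p" using inherited n by auto
      with inherited(1) show ?thesis by (rule deviates.imposed)
    qed
  qed
qed

section \<open>The Dirac law at a deterministic schedule\<close>

context schedule_space
begin

lemma AE_return_outcomes_eq:
  assumes "\<omega> \<in> schedules V S" "\<And>v. v \<in> V \<Longrightarrow> \<omega> (v, m) = \<omega> (v, m')"
    and m: "m \<in> interventions V S" "m' \<in> interventions V S"
  shows "AE \<omega>' in return A \<omega>. outcomes V m \<omega>' = outcomes V m' \<omega>'"
proof -
  have "outcomes V m \<omega> = outcomes V m' \<omega>" using assms(2) by (auto simp: outcomes_def)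
  moreover have "{\<omega>' \<in> space A. outcomes V m \<omega>' = outcomes V m' \<omega>'} \<in> sets A"
    using m by (intro countably_separated_Collect_eq[OF countably_separated_states[OF subset_refl]] measurable_outcomes) auto
  ultimately show ?thesis
    using assms(1) by (simp add: AE_return_iff space_A)
qed

text \<open>The conditioning variable is deterministic, so consistency becomes a pointwise equation
  for \<open>\<omega>\<close> at the one value \<open>?Y \<omega>\<close>.\<close>

lemma consistent_return:
  assumes \<omega>: "\<omega> \<in> schedules V S"
    and cons: "\<And>I I' a v. \<lbrakk>I \<subseteq> V; I' \<subseteq> V; I \<inter> I' = {}; a \<in> space (Pi\<^sub>M I S); v \<in> V\<rbrakk> \<Longrightarrow>
      \<omega> (v, setting a I ++ setting (outcomes I' (setting a I) \<omega>) I') = \<omega> (v, setting a I)"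
  shows "consistent V S (return A \<omega>)"
  unfolding consistent_def
proof (intro allI impI ballI)
  fix I I' a assume I: "I \<subseteq> V" "I' \<subseteq> V" "I \<inter> I' = {}" and a: "a \<in> space (Pi\<^sub>M I S)"
  let ?Y = "outcomes I' (setting a I)" and ?N = "Pi\<^sub>M I' S"
  have m: "setting a I \<in> interventions V S" using a subset_refl I(1) by (rule setting_interventions)
  have mb: "setting a I ++ setting b I' \<in> interventions V S" if "b \<in> space ?N" for b
    using that I(2) by (intro map_add_interventions[OF m] setting_interventions[OF that]) auto
  have Y: "?Y \<in> measurable A ?N" using I(2) m by (rule measurable_outcomes)
  have \<omega>A: "\<omega> \<in> space A" using \<omega> by (simp add: space_A)
  have "\<exists>y. y \<in> space (S u)" if "u \<in> V" for u
    using state_space_two_points[OF that] by blast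
  then obtain t where t: "\<And>u. u \<in> V \<Longrightarrow> t u \<in> space (S u)" by metis
  \<comment> \<open>On the null set of values not attained by \<open>\<omega>\<close>, any law of schedules that ignore
      interventions serves as conditional law.\<close>
  define \<omega>' where "\<omega>' = (\<lambda>(v, m)\<in>V \<times> interventions V S. t v)"
  have \<omega>': "\<omega>' \<in> schedules V S"
    using t by (auto simp: \<omega>'_def schedules_def)
  define \<kappa> where "\<kappa> = (\<lambda>y. if y = ?Y \<omega> then return A \<omega> else return A \<omega>')"
  have "regular_conditional_distribution (return A \<omega>) ?N ?Y \<kappa>"
    unfolding \<kappa>_def
  proof (rule regular_conditional_distribution_return[OF \<omega>A Y])
    show "{?Y \<omega>} \<in> sets ?N"
      using countably_separated_states[OF I(2)] measurable_space[OF Y \<omega>A]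
      by (rule countably_separated_singleton)
    show "prob_space (return A \<omega>')" using \<omega>' by (intro prob_space_return) (simp add: space_A)
  qed simp
  moreover have "AE \<omega> in \<kappa> b.
      outcomes V (setting a I ++ setting b I') \<omega> = outcomes V (setting a I) \<omega>"
    if b: "b \<in> space ?N" for b
  proof (cases "b = ?Y \<omega>")
    case True
    then have "\<kappa> b = return A \<omega>" by (simp add: \<kappa>_def)
    then show ?thesis
      using AE_return_outcomes_eq[OF \<omega> _ mb[OF b] m] cons[OF I a] True by metis
  next
    case False
    then have "\<kappa> b = return A \<omega>'" by (simp add: \<kappa>_def)
    moreover have "\<omega>' (v, setting a I ++ setting b I') = \<omega>' (v, setting a I)" if "v \<in> V" for v
      using that mb[OF b] m by (simp add: \<omega>'_def)
    ultimately show ?thesis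
      using AE_return_outcomes_eq[OF \<omega>' _ mb[OF b] m] by metis
  qed
  ultimately show "\<exists>\<kappa>. regular_conditional_distribution (return A \<omega>) ?N ?Y \<kappa> \<and>
      (\<forall>b\<in>space ?N. AE \<omega> in \<kappa> b.
        outcomes V (setting a I ++ setting b I') \<omega> = outcomes V (setting a I) \<omega>)"
    by blast
qed

text \<open>If \<open>(w, v)\<close> is an edge of \<open>D\<close> but not of \<open>D'\<close>,
  compare two interventions on all of \<open>V\<close> that differ only at \<open>w\<close>. They
  give \<open>v\<close> different outcomes, whereas in the model of \<open>D'\<close> the outcome of
  \<open>v\<close> depends only on the values imposed on its parents in \<open>D'\<close>.\<close>

lemma faithful_law_exists:
  assumes D: "D \<in> dags V"
  obtains P where "P \<in> dag_model V S A D"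
    and "\<And>D'. D' \<in> dags V \<Longrightarrow> P \<in> dag_model V S A D' \<Longrightarrow> D \<subseteq> D'"
proof -
  have "\<forall>v\<in>V. \<exists>z. fst z \<in> space (S v) \<and> snd z \<in> space (S v) \<and> fst z \<noteq> snd z"
    using state_space_two_points by (metis fst_conv snd_conv)
  from bchoice[OF this] obtain z where z: "\<forall>v\<in>V. fst (z v) \<in> space (S v) \<and>
      snd (z v) \<in> space (S v) \<and> fst (z v) \<noteq> snd (z v)" ..
  define s t where "s v = fst (z v)" and "t v = snd (z v)" for v
  have st: "s v \<in> space (S v)" "t v \<in> space (S v)" "s v \<noteq> t v" "t v \<noteq> s v" if "v \<in> V" for v
    using z that by (auto simp: s_def t_def)
  define \<omega> where "\<omega> = conj_schedule V S D s t"
  have \<omega>_eq: "\<omega> (v, m) = (if deviates D s m v then t v else s v)"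
    if "v \<in> V" "m \<in> interventions V S" for v m
    using that by (simp add: \<omega>_def conj_schedule_def)
  have \<omega>_space: "\<omega> (v, m) \<in> space (S v)" if "v \<in> V" "m \<in> interventions V S" for v m
    using that st by (simp add: \<omega>_eq)
  have \<omega>: "\<omega> \<in> schedules V S"
    using \<omega>_space by (auto simp: schedules_def \<omega>_def conj_schedule_def)
  then have \<omega>A: "\<omega> \<in> space A" by (simp add: space_A)
  have par: "parents D' v \<subseteq> V" if "D' \<in> dags V" for D' v
    using that by (auto simp: parents_def dags_def)
  have out: "setting (outcomes J m \<omega>) J \<in> interventions V S"
    if "J \<subseteq> V" "m \<in> interventions V S" for J m
    using that \<omega>_space by (auto simp: interventions_iff setting_apply outcomes_apply split: if_splits)
  show thesis
  proof (rule that)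
    have "consistent V S (return A \<omega>)"
    proof (rule consistent_return[OF \<omega>])
      fix I I' a v
      assume I: "I \<subseteq> V" "I' \<subseteq> V" "I \<inter> I' = {}" and a: "a \<in> space (Pi\<^sub>M I S)" and v: "v \<in> V"
      let ?n = "setting (outcomes I' (setting a I) \<omega>) I'"
      have m: "setting a I \<in> interventions V S" using a subset_refl I(1) by (rule setting_interventions)
      \<comment> \<open>The outcome of a vertex \<open>p\<close> differs from \<open>s p\<close>
        exactly if \<open>p\<close> deviates, because \<open>t p \<noteq> s p\<close>.\<close>
      have "deviates D s (setting a I ++ ?n) v \<longleftrightarrow> deviates D s (setting a I) v"
        using I st m
        by (intro deviates_consistent)
          (auto simp: setting_apply outcomes_apply \<omega>_eq split: if_splits)
      then show "\<omega> (v, setting a I ++ ?n) = \<omega> (v, setting a I)"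
        using v m map_add_interventions[OF m out[OF I(2) m]] by (simp add: \<omega>_eq)
    qed
    then have "return A \<omega> \<in> causal_model V S A"
      using prob_space_return[OF \<omega>A] by (simp add: causal_model_def)
    moreover have "AE \<omega> in return A \<omega>. \<omega> (v, setting x I) =
        \<omega> (v, setting x (parents D v \<inter> I) ++
          setting (outcomes (parents D v - I) (setting x I) \<omega>) (parents D v - I))"
      if v: "v \<in> V" and I: "I \<subseteq> V" and x: "x \<in> space (Pi\<^sub>M V S)" for v I x
    proof -
      let ?Q = "parents D v"
      let ?m = "\<lambda>\<omega>. setting x (?Q \<inter> I) ++ setting (outcomes (?Q - I) (setting x I) \<omega>) (?Q - I)"
      have m: "setting x I \<in> interventions V S" "setting x (?Q \<inter> I) \<in> interventions V S"
        using I by (auto intro!: setting_interventions[OF x])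
      have m': "?m \<omega> \<in> interventions V S"
        using par[OF D, of v] by (intro map_add_interventions m out) auto
      have "deviates D s (?m \<omega>) v \<longleftrightarrow> deviates D s (setting x I) v"
        using par[OF D, of v] st m
        by (intro deviates_parents)
          (auto simp: setting_apply map_add_def outcomes_apply \<omega>_eq parents_def split: if_splits)
      then have "\<omega> (v, setting x I) = \<omega> (v, ?m \<omega>)" using v m m' by (simp add: \<omega>_eq)
      moreover have "{\<omega> \<in> space A. \<omega> (v, setting x I) = \<omega> (v, ?m \<omega>)} \<in> sets A"
      proof (rule countably_separated_Collect_eq)
        show "countably_separated (S v)" using state_spaces v by (simp add: state_spaces_def)
        show "(\<lambda>\<omega>. \<omega> (v, ?m \<omega>)) \<in> measurable A (S v)"
          using par[OF D, of v] by (intro measurable_outcome[OF v I _ _ x]) auto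
      qed (use v m(1) in \<open>rule measurable_coordinate\<close>)
      ultimately show ?thesis by (simp add: AE_return_iff[OF \<omega>A])
    qed
    moreover have "prob_space.indep_vars (return A \<omega>) S (\<lambda>v \<omega>. \<omega> (v, setting x (parents D v))) V"
      if x: "x \<in> space (Pi\<^sub>M V S)" for x
      using x par[OF D]
      by (intro indep_vars_return[OF \<omega>A] measurable_coordinate setting_interventions[OF x]) auto
    ultimately show "return A \<omega> \<in> dag_model V S A D" by (simp add: dag_model_def)
  next
    fix D' assume D': "D' \<in> dags V" and P: "return A \<omega> \<in> dag_model V S A D'"
    show "D \<subseteq> D'"
    proof (rule subrelI, rule ccontr)
      fix w v assume wv: "(w, v) \<in> D" "(w, v) \<notin> D'"
      then have w: "w \<in> V" and v: "v \<in> V" using D by (auto simp: dags_def)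
      \<comment> \<open>Under \<open>x\<close> every parent of \<open>v\<close> has its value from
        \<open>s\<close>, so \<open>v\<close> does not deviate; \<open>x'\<close> spoils this at the
        single parent \<open>w\<close>.\<close>
      define x where "x = restrict s V"
      define x' where "x' = x(w := t w)"
      have x: "x \<in> space (Pi\<^sub>M V S)" "x' \<in> space (Pi\<^sub>M V S)"
        using st w by (auto simp: x_def x'_def space_PiM PiE_iff extensional_def)
      \<comment> \<open>Recursive substitution with \<open>I = V\<close>, where all parents are
        imposed. The almost sure equation under the point mass holds at \<open>\<omega>\<close>
        itself.\<close>
      have eq: "\<omega> (v, setting y V) = \<omega> (v, setting y (parents D' v))"
        if y: "y \<in> space (Pi\<^sub>M V S)" for y
      proof -
        have "AE \<omega> in return A \<omega>. \<omega> (v, setting y V) = \<omega> (v, setting y (parents D' v))"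
        proof -
          have "parents D' v \<inter> V = parents D' v" "parents D' v - V = {}" using par[OF D', of v] by auto
          then show ?thesis
            using dag_modelD(2)[OF P v subset_refl y] by (simp only: setting_empty map_add_empty)
        qed
        moreover have "{\<omega> \<in> space A. \<omega> (v, setting y V) = \<omega> (v, setting y (parents D' v))} \<in> sets A"
          using state_spaces v y par[OF D', of v]
          by (intro countably_separated_Collect_eq[of "S v"] measurable_coordinate setting_interventions[OF y])
            (auto simp: state_spaces_def)
        ultimately show ?thesis by (simp add: AE_return_iff[OF \<omega>A])
      qed
      have "setting x (parents D' v) = setting x' (parents D' v)"
        using wv(2) by (intro setting_cong) (auto simp: x'_def parents_def)
      then have "\<omega> (v, setting x V) = \<omega> (v, setting x' V)" using eq x by simp
      moreover have "\<not> deviates D s (setting x V) v"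
      proof
        assume "deviates D s (setting x V) v"
        then show False
          using D by cases (auto simp: dags_def setting_apply x_def split: if_splits)
      qed
      moreover have "deviates D s (setting x' V) v"
        using wv(1) w st by (intro deviates.imposed[of w v D _ "t w"]) (auto simp: setting_apply x'_def)
      ultimately show False
        using x v st[OF v] by (simp add: \<omega>_eq setting_interventions[OF _ subset_refl])
    qed
  qed
qed

end

section \<open>Order of MPDAGs and their DAGs\<close>

lemma represents_represented_dags:
  "G \<in> mpdags V \<Longrightarrow> represents V G (represented_dags V G)"
  using represented_dags_eq by (fastforce simp: mpdags_def)

lemma directed_eq_Inter: "G \<in> mpdags V \<Longrightarrow> directed G = \<Inter>(represented_dags V G)"
  using represents_represented_dags[of G V] by (auto simp: represents_def pdag_of_def)

lemma mpdag_eq_iff: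
  assumes "G \<in> mpdags V" "G' \<in> mpdags V"
  shows "G = G' \<longleftrightarrow> represented_dags V G = represented_dags V G'"
  using assms represents_represented_dags unfolding represents_def by metis

lemma represented_dags_nonempty: "G \<in> mpdags V \<Longrightarrow> represented_dags V G \<noteq> {}"
  using represents_represented_dags[of G V] by (simp add: represents_def)

lemma represented_dags_subset: "G \<in> mpdags V \<Longrightarrow> represented_dags V G \<subseteq> dags V"
  using represents_represented_dags[of G V] by (auto simp: represents_def compatible_dags_def)

lemma represented_dags_skeleton:
  assumes "G \<in> mpdags V" "D \<in> represented_dags V G" "D' \<in> represented_dags V G"
  shows "skeleton D = skeleton D'"
proof -
  note rep = represents_represented_dags[OF assms(1)]
  show ?thesis
    by (simp only: represents_skeleton[OF rep assms(2)] represents_skeleton[OF rep assms(3)])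
qed

text \<open>A represented set is determined by any one of its DAGs together with the directed edges;
  the inclusion supplies a common DAG.\<close>

lemma mpdag_eqI:
  assumes G: "G \<in> mpdags V" "G' \<in> mpdags V"
    and sub: "represented_dags V G \<subseteq> represented_dags V G'" and "directed G = directed G'"
  shows "G = G'"
proof -
  obtain D where D: "D \<in> represented_dags V G" using represented_dags_nonempty[OF G(1)] by blast
  then have D': "D \<in> represented_dags V G'" using sub by blast
  have "represented_dags V G = represented_dags V G'"
    by (simp only: represents_eq[OF represents_represented_dags[OF G(1)] D]
        represents_eq[OF represents_represented_dags[OF G(2)] D'] assms(4))
  then show ?thesis using mpdag_eq_iff[OF G] by simp
qed

lemma finite_mpdags:
  assumes "finite V" shows "finite (mpdags V)"
proof (rule finite_subset)
  show "mpdags V \<subseteq> pdag_of ` Pow (Pow (V \<times> V))"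
    by (auto simp: mpdags_def represents_def compatible_dags_def dags_def)
  show "finite (pdag_of ` Pow (Pow (V \<times> V)))" using assms by simp
qed

lemma compatible_mpdag:
  assumes "D0 \<in> dags V" "D \<in> compatible_dags V D0 K"
  shows "pdag_of (compatible_dags V D0 K) \<in> mpdags V"
    and "represented_dags V (pdag_of (compatible_dags V D0 K)) = compatible_dags V D0 K"
proof -
  have "represents V (pdag_of (compatible_dags V D0 K)) (compatible_dags V D0 K)"
    using assms by (auto simp: represents_def)
  then show "pdag_of (compatible_dags V D0 K) \<in> mpdags V"
    and "represented_dags V (pdag_of (compatible_dags V D0 K)) = compatible_dags V D0 K"
    by (auto simp: mpdags_def represented_dags_eq)
qed

text \<open>Computes the directed edges without listing the whole class: two members that share no
  edge outside \<open>K\<close> suffice.\<close>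

lemma directed_compatible:
  assumes "D \<in> compatible_dags V D0 K" "D' \<in> compatible_dags V D0 K" "D \<inter> D' \<subseteq> K"
  shows "directed (pdag_of (compatible_dags V D0 K)) = K"
proof
  show "directed (pdag_of (compatible_dags V D0 K)) \<subseteq> K"
    using assms by (simp add: pdag_of_def) blast
  show "K \<subseteq> directed (pdag_of (compatible_dags V D0 K))"
    by (auto simp: pdag_of_def compatible_dags_def)
qed

lemma doubleton_skeleton_iff: "{u, v} \<in> skeleton D \<longleftrightarrow> (u, v) \<in> D \<or> (v, u) \<in> D"
  by (auto simp: skeleton_def doubleton_eq_iff)

lemma skeleton_mono: "D \<subseteq> D' \<Longrightarrow> skeleton D \<subseteq> skeleton D'"
  by (auto simp: skeleton_def)

text \<open>An additional edge of \<open>D'\<close> would join vertices that are adjacent in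
  \<open>D\<close>, necessarily in the other direction, and \<open>D'\<close> would contain a
  2-cycle.\<close>

lemma subdag_eqI:
  assumes "D \<subseteq> D'" "acyclic D'" "skeleton D' \<subseteq> skeleton D"
  shows "D = D'"
proof
  show "D' \<subseteq> D"
  proof (rule subrelI, rule ccontr)
    fix u v assume uv: "(u, v) \<in> D'" "(u, v) \<notin> D"
    then have "{u, v} \<in> skeleton D" using assms(3) doubleton_skeleton_iff by fastforce
    then have "(v, u) \<in> D'" using uv assms(1) by (auto simp: doubleton_skeleton_iff)
    then have "(u, u) \<in> D'\<^sup>+" using uv(1) by auto
    then show False using assms(2) by (simp add: acyclic_def)
  qed
qed (fact assms(1))

section \<open>Necessary and sufficient conditions for the order\<close>

context schedule_space
begin

text \<open>The faithful law of \<open>D\<close> lies in the model of some DAG of \<open>G'\<close>,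
  and faithfulness forces that DAG to contain \<open>D\<close>.\<close>

lemma mpdag_order_dag_subset:
  assumes "(G, G') \<in> mpdag_order V S A" "D \<in> represented_dags V G"
  obtains D' where "D' \<in> represented_dags V G'" "D \<subseteq> D'"
proof -
  have G: "G \<in> mpdags V" "G' \<in> mpdags V" and sub: "mpdag_model V S A G \<subseteq> mpdag_model V S A G'"
    using assms(1) by (auto simp: mpdag_order_def)
  have "D \<in> dags V" using represented_dags_subset[OF G(1)] assms(2) by blast
  then obtain P where P: "P \<in> dag_model V S A D"
    and faithful: "\<And>D'. D' \<in> dags V \<Longrightarrow> P \<in> dag_model V S A D' \<Longrightarrow> D \<subseteq> D'"
    by (rule faithful_law_exists) blast
  have "P \<in> mpdag_model V S A G'" using P assms(2) sub by (auto simp: mpdag_model_def)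
  then obtain D' where "D' \<in> represented_dags V G'" "P \<in> dag_model V S A D'"
    by (auto simp: mpdag_model_def)
  then show thesis using that faithful represented_dags_subset[OF G(2)] by blast
qed

lemma mpdag_order_skeleton:
  assumes "(G, G') \<in> mpdag_order V S A" "D \<in> represented_dags V G" "D' \<in> represented_dags V G'"
  shows "skeleton D \<subseteq> skeleton D'"
proof -
  obtain D'' where "D'' \<in> represented_dags V G'" "D \<subseteq> D''"
    using assms(1,2) by (rule mpdag_order_dag_subset)
  moreover have "G' \<in> mpdags V" using assms(1) by (simp add: mpdag_order_def)
  ultimately show ?thesis using represented_dags_skeleton assms(3) skeleton_mono by metis
qed

text \<open>Once the skeletons agree, the DAG of \<open>G'\<close> that contains a given DAG of
  \<open>G\<close> has no room for further edges and equals it.\<close>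

lemma mpdag_order_represented_subset:
  assumes ord: "(G, G') \<in> mpdag_order V S A"
    and D: "D \<in> represented_dags V G" and D': "D' \<in> represented_dags V G'"
    and sk: "skeleton D' \<subseteq> skeleton D"
  shows "represented_dags V G \<subseteq> represented_dags V G'"
proof
  have G: "G \<in> mpdags V" "G' \<in> mpdags V" using ord by (auto simp: mpdag_order_def)
  fix E assume E: "E \<in> represented_dags V G"
  then obtain E' where E': "E' \<in> represented_dags V G'" "E \<subseteq> E'"
    using ord mpdag_order_dag_subset by blast
  have "skeleton E' \<subseteq> skeleton E"
    using sk represented_dags_skeleton[OF G(1) E D] represented_dags_skeleton[OF G(2) E'(1) D'] by simp
  moreover have "acyclic E'" using E'(1) represented_dags_subset[OF G(2)] by (auto simp: dags_def)
  ultimately show "E \<in> represented_dags V G'" using subdag_eqI E' by metis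
qed

lemma mpdag_orderI:
  assumes "G \<in> mpdags V" "G' \<in> mpdags V"
    and "\<And>D. D \<in> represented_dags V G \<Longrightarrow>
      \<exists>D'\<in>represented_dags V G'. dag_model V S A D \<subseteq> dag_model V S A D'"
  shows "(G, G') \<in> mpdag_order V S A"
  using assms by (fastforce simp: mpdag_order_def mpdag_model_def)

lemma trans_mpdag_order: "trans (mpdag_order V S A)"
  by (rule transI) (auto simp: mpdag_order_def)

text \<open>The skeletons contain each other, hence so do the sets of represented DAGs.\<close>

lemma antisym_mpdag_order: "antisym (mpdag_order V S A)"
proof (rule antisymI)
  fix G G' assume ord: "(G, G') \<in> mpdag_order V S A" "(G', G) \<in> mpdag_order V S A"
  then have G: "G \<in> mpdags V" "G' \<in> mpdags V" by (auto simp: mpdag_order_def)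
  then obtain D D' where D: "D \<in> represented_dags V G" "D' \<in> represented_dags V G'"
    using represented_dags_nonempty by blast
  have "represented_dags V G = represented_dags V G'"
    using mpdag_order_represented_subset[OF ord(1) D] mpdag_order_represented_subset[OF ord(2) D(2,1)]
      mpdag_order_skeleton[OF ord(1) D] mpdag_order_skeleton[OF ord(2) D(2,1)] by blast
  then show "G = G'" using mpdag_eq_iff[OF G] by simp
qed

end

text \<open>In a finite poset strict relations are chains of covers. The induction is on the size of
  the interval, which shrinks when it is split at an intermediate element.\<close>

lemma rank_strict_mono:
  fixes rank :: "'a \<Rightarrow> nat"
  assumes "finite X" "trans r" "antisym r" "r \<subseteq> X \<times> X" and refl: "\<And>x. x \<in> X \<Longrightarrow> (x, x) \<in> r"
    and rank: "\<And>x y. covers r x y \<Longrightarrow> rank y = rank x + 1"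
    and xy: "(x, y) \<in> r" "x \<noteq> y"
  shows "rank x < rank y"
  using xy
proof (induction "card {z. (x, z) \<in> r \<and> (z, y) \<in> r}" arbitrary: x y rule: less_induct)
  case less
  let ?I = "\<lambda>x y. {z. (x, z) \<in> r \<and> (z, y) \<in> r}"
  show ?case
  proof (cases "covers r x y")
    case True
    then show ?thesis using rank by simp
  next
    case False
    then obtain z where z: "(x, z) \<in> r" "x \<noteq> z" "(z, y) \<in> r" "z \<noteq> y"
      using less.prems by (auto simp: covers_def)
    have fin: "finite (?I x y)"
      using assms(1,4) by (rule_tac finite_subset[of _ X]) auto
    have "(z, x) \<notin> r" "(y, z) \<notin> r" using z assms(3) by (auto dest: antisymD)
    moreover have "x \<in> ?I x y" "y \<in> ?I x y" using less.prems assms(4) refl by auto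
    moreover have "?I x z \<subseteq> ?I x y" "?I z y \<subseteq> ?I x y" using z assms(2) by (auto dest: transD)
    \<comment> \<open>The first interval misses \<open>y\<close> and the second misses
      \<open>x\<close>.\<close>
    ultimately have "?I x z \<subset> ?I x y" "?I z y \<subset> ?I x y" by auto
    then have "card (?I x z) < card (?I x y)" "card (?I z y) < card (?I x y)"
      using psubset_card_mono[OF fin] by auto
    then have "rank x < rank z" "rank z < rank y" using less.hyps z by auto
    then show ?thesis by simp
  qed
qed

section \<open>MPDAGs on three vertices\<close>

text \<open>The complete DAG on three vertices with topological order \<open>x\<close>,
  \<open>y\<close>, \<open>z\<close>.\<close>

definition tri :: "'v \<Rightarrow> 'v \<Rightarrow> 'v \<Rightarrow> 'v digraph" where
  "tri x y z = {(x, y), (x, z), (y, z)}"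

lemma tri_dag:
  assumes "x \<in> V" "y \<in> V" "z \<in> V" "x \<noteq> y" "x \<noteq> z" "y \<noteq> z"
  shows "tri x y z \<in> dags V"
proof -
  have "acyclic (tri x y z)"
    using assms(4-6)
    \<comment> \<open>The function decreases along edges: 2 at \<open>x\<close>, 1 at
      \<open>y\<close>, 0 at \<open>z\<close>.\<close>
    by (intro acyclicI_order[where f = "\<lambda>u. if u = x then 2 else if u = y then 1 else (0 :: nat)"])
      (auto simp: tri_def)
  then show ?thesis using assms(1-3) by (auto simp: dags_def tri_def)
qed

lemma subset_dag: "D' \<in> dags V \<Longrightarrow> D \<subseteq> D' \<Longrightarrow> D \<in> dags V"
  by (auto simp: dags_def intro: acyclic_subset)

lemma skeleton_insert: "skeleton (insert (x, y) D) = insert {x, y} (skeleton D)"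
  by (auto simp: skeleton_def)

lemma skeleton_empty: "skeleton {} = {}"
  by (simp add: skeleton_def)

lemma skeleton_tri: "skeleton (tri x y z) = {{x, y}, {x, z}, {y, z}}"
  by (simp add: tri_def skeleton_insert skeleton_empty)

lemma v_structures_tri: "v_structures (tri x y z) = {}"
  unfolding v_structures_def skeleton_tri by (auto simp: tri_def insert_commute)

text \<open>Since the edge from \<open>x\<close> to \<open>y\<close> is present, all missing edges
  point into \<open>z\<close>, so \<open>dag_model_add_parents\<close> adds them with
  \<open>{x, y}\<close> as the new parents of \<open>z\<close>.\<close>

lemma (in schedule_space) dag_model_subset_tri:
  assumes "x \<in> V" "y \<in> V" "z \<in> V" "x \<noteq> y" "x \<noteq> z" "y \<noteq> z"
    and D: "D \<subseteq> tri x y z" "(x, y) \<in> D"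
  shows "dag_model V S A D \<subseteq> dag_model V S A (tri x y z)"
proof -
  have eq: "D \<union> {x, y} \<times> {z} = tri x y z" using D by (auto simp: tri_def)
  have dag: "tri x y z \<in> dags V" by (rule tri_dag[OF assms(1-6)])
  show ?thesis
  proof (rule dag_model_add_parents[of D z "{x, y}", unfolded eq])
    show "D \<in> dags V" using dag D(1) by (rule subset_dag)
    have "tri x y z \<subseteq> insert z {x, y} \<times> insert z {x, y}" by (simp add: tri_def)
    with D(1) show "D \<subseteq> insert z {x, y} \<times> insert z {x, y}" by (rule subset_trans)
  qed (use assms(1-3) dag in simp_all)
qed

section \<open>MPDAGs whose skeleton is a path or a triangle\<close>

locale three_vertices = schedule_space V S A
  for V :: "'v set" and S :: "'v \<Rightarrow> 'x measure" and A :: "('v, 'x) schedule measure" +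
  fixes a b c :: 'v
  assumes abc: "a \<in> V" "b \<in> V" "c \<in> V" "a \<noteq> b" "a \<noteq> c" "b \<noteq> c"
begin

definition path_pdag :: "'v digraph \<Rightarrow> 'v pdag" where
  "path_pdag K = pdag_of (compatible_dags V {(a, b), (a, c)} K)"

definition triangle_pdag :: "'v digraph \<Rightarrow> 'v pdag" where
  "triangle_pdag K = pdag_of (compatible_dags V (tri a b c) K)"

lemma tris_dags: "tri a b c \<in> dags V" "tri b a c \<in> dags V" "tri b c a \<in> dags V"
  "tri c a b \<in> dags V" "tri c b a \<in> dags V"
  using abc by (auto intro!: tri_dag)

lemma path_dags: "{(a, b), (a, c)} \<in> dags V" "{(b, a), (a, c)} \<in> dags V" "{(c, a), (a, b)} \<in> dags V"
  by (rule subset_dag[OF tris_dags(1)] subset_dag[OF tris_dags(2)] subset_dag[OF tris_dags(4)],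
      simp add: tri_def)+

lemma compatible_triangle_iff:
  "D \<in> compatible_dags V (tri a b c) K \<longleftrightarrow>
    D \<in> dags V \<and> skeleton D = {{a, b}, {a, c}, {b, c}} \<and> v_structures D = {} \<and> K \<subseteq> D"
  by (auto simp: compatible_dags_def markov_equivalent_def skeleton_tri v_structures_tri)

lemma compatible_path_iff:
  "D \<in> compatible_dags V {(a, b), (a, c)} K \<longleftrightarrow>
    D \<in> dags V \<and> skeleton D = {{a, b}, {a, c}} \<and> v_structures D = {} \<and> K \<subseteq> D"
proof -
  have "v_structures {(a, b), (a, c)} = {}" by (auto simp: v_structures_def)
  then show ?thesis
    by (auto simp: compatible_dags_def markov_equivalent_def skeleton_insert skeleton_empty)
qed

lemma tris_compatible:
  "K \<subseteq> tri a b c \<Longrightarrow> tri a b c \<in> compatible_dags V (tri a b c) K"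
  "K \<subseteq> tri b a c \<Longrightarrow> tri b a c \<in> compatible_dags V (tri a b c) K"
  "K \<subseteq> tri b c a \<Longrightarrow> tri b c a \<in> compatible_dags V (tri a b c) K"
  "K \<subseteq> tri c a b \<Longrightarrow> tri c a b \<in> compatible_dags V (tri a b c) K"
  "K \<subseteq> tri c b a \<Longrightarrow> tri c b a \<in> compatible_dags V (tri a b c) K"
  using tris_dags
  by (auto simp: compatible_triangle_iff skeleton_tri v_structures_tri insert_commute)

lemma paths_compatible:
  "K \<subseteq> {(a, b), (a, c)} \<Longrightarrow> {(a, b), (a, c)} \<in> compatible_dags V {(a, b), (a, c)} K"
  "K \<subseteq> {(b, a), (a, c)} \<Longrightarrow> {(b, a), (a, c)} \<in> compatible_dags V {(a, b), (a, c)} K"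
  "K \<subseteq> {(c, a), (a, b)} \<Longrightarrow> {(c, a), (a, b)} \<in> compatible_dags V {(a, b), (a, c)} K"
  using abc path_dags
  by (auto simp: compatible_path_iff skeleton_insert skeleton_empty v_structures_def insert_commute)

text \<open>Two edges into \<open>a\<close> would form a v-structure, as \<open>b\<close> and
  \<open>c\<close> are not adjacent. Each other orientation contains one of the listed DAGs, and
  \<open>subdag_eqI\<close> gives equality.\<close>

lemma compatible_path_cases:
  assumes "D \<in> compatible_dags V {(a, b), (a, c)} K"
  shows "D = {(a, b), (a, c)} \<or> D = {(b, a), (a, c)} \<or> D = {(c, a), (a, b)}"
proof -
  have D: "acyclic D" "skeleton D = {{a, b}, {a, c}}" "v_structures D = {}"
    using assms by (auto simp: compatible_path_iff dags_def)
  have eq: "F = D" if "F \<subseteq> D" "skeleton F = {{a, b}, {a, c}}" for F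
    using that D by (intro subdag_eqI) auto
  have ab: "(a, b) \<in> D \<or> (b, a) \<in> D" and ac: "(a, c) \<in> D \<or> (c, a) \<in> D"
    using D(2) by (auto simp flip: doubleton_skeleton_iff)
  have "\<not> ((b, a) \<in> D \<and> (c, a) \<in> D)"
  proof
    assume "(b, a) \<in> D \<and> (c, a) \<in> D"
    moreover have "{b, c} \<notin> skeleton D" using abc D(2) by (auto simp: doubleton_eq_iff)
    ultimately have "(b, a, c) \<in> v_structures D" using abc by (simp add: v_structures_def)
    then show False using D(3) by simp
  qed
  then consider "{(a, b), (a, c)} \<subseteq> D" | "{(b, a), (a, c)} \<subseteq> D" | "{(c, a), (a, b)} \<subseteq> D"
    using ab ac by auto
  then show ?thesis
    by cases (drule eq; simp add: skeleton_insert skeleton_empty insert_commute)+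
qed

lemma path_mpdag:
  assumes "K \<subseteq> {(a, b), (a, c)}"
  shows "path_pdag K \<in> mpdags V" "represented_dags V (path_pdag K) = compatible_dags V {(a, b), (a, c)} K"
  unfolding path_pdag_def using compatible_mpdag[OF path_dags(1) paths_compatible(1)[OF assms]] by auto

lemma triangle_mpdag:
  assumes "K \<subseteq> tri a b c"
  shows "triangle_pdag K \<in> mpdags V" "represented_dags V (triangle_pdag K) = compatible_dags V (tri a b c) K"
  unfolding triangle_pdag_def using compatible_mpdag[OF tris_dags(1) tris_compatible(1)[OF assms]] by auto

text \<open>The chains from \<open>b\<close> to \<open>c\<close> and from \<open>c\<close> to
  \<open>b\<close> have no common edge; the fork at \<open>a\<close> and the chain from
  \<open>b\<close> to \<open>c\<close> share only \<open>(a, c)\<close>.\<close>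

lemma directed_path: "directed (path_pdag {}) = {}" "directed (path_pdag {(a, c)}) = {(a, c)}"
proof -
  show "directed (path_pdag {}) = {}"
    unfolding path_pdag_def
    by (rule directed_compatible[OF paths_compatible(2,3)]) (use abc in auto)
  show "directed (path_pdag {(a, c)}) = {(a, c)}"
    unfolding path_pdag_def
    by (rule directed_compatible[OF paths_compatible(1,2)]) (use abc in auto)
qed

text \<open>In each case \<open>tri a b c\<close> is intersected with a second order: its reversal,
  then the one moving \<open>a\<close> to the end, then the one swapping \<open>a\<close> and
  \<open>b\<close>.\<close>

lemma directed_triangle: "directed (triangle_pdag {}) = {}"
  "directed (triangle_pdag {(b, c)}) = {(b, c)}"
  "directed (triangle_pdag {(a, c), (b, c)}) = {(a, c), (b, c)}"
proof -
  show "directed (triangle_pdag {}) = {}"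
    unfolding triangle_pdag_def
    by (rule directed_compatible[OF tris_compatible(1,5)]) (use abc in \<open>auto simp: tri_def\<close>)
  show "directed (triangle_pdag {(b, c)}) = {(b, c)}"
    unfolding triangle_pdag_def
    by (rule directed_compatible[OF tris_compatible(1,3)]) (use abc in \<open>auto simp: tri_def\<close>)
  show "directed (triangle_pdag {(a, c), (b, c)}) = {(a, c), (b, c)}"
    unfolding triangle_pdag_def
    by (rule directed_compatible[OF tris_compatible(1,2)]) (use abc in \<open>auto simp: tri_def\<close>)
qed

section \<open>The relations of the two chains\<close>

lemma order_path_path: "(path_pdag {(a, c)}, path_pdag {}) \<in> mpdag_order V S A"
  by (rule mpdag_orderI) (auto simp: path_mpdag compatible_path_iff)

lemma order_triangles:
  "(triangle_pdag {(a, c), (b, c)}, triangle_pdag {(b, c)}) \<in> mpdag_order V S A"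
  "(triangle_pdag {(b, c)}, triangle_pdag {}) \<in> mpdag_order V S A"
proof -
  have K: "{(b, c)} \<subseteq> tri a b c" "{(a, c), (b, c)} \<subseteq> tri a b c" by (auto simp: tri_def)
  show "(triangle_pdag {(a, c), (b, c)}, triangle_pdag {(b, c)}) \<in> mpdag_order V S A"
    "(triangle_pdag {(b, c)}, triangle_pdag {}) \<in> mpdag_order V S A"
    using K by (auto intro!: mpdag_orderI simp: triangle_mpdag compatible_triangle_iff)
qed

lemma path_triangle_models:
  "dag_model V S A {(a, b), (a, c)} \<subseteq> dag_model V S A (tri a b c)"
  "dag_model V S A {(b, a), (a, c)} \<subseteq> dag_model V S A (tri b a c)"
  "dag_model V S A {(c, a), (a, b)} \<subseteq> dag_model V S A (tri c a b)"
  using abc by (intro dag_model_subset_tri; auto simp: tri_def)+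

text \<open>Each path is completed by an edge into its last vertex. With \<open>(a, c)\<close>
  directed only two paths remain, and both are completed by \<open>(b, c)\<close>; this is why
  \<open>(b, c)\<close> can be directed in the upper MPDAG.\<close>

lemma order_path_triangle:
  "(path_pdag {(a, c)}, triangle_pdag {(a, c), (b, c)}) \<in> mpdag_order V S A"
  "(path_pdag {}, triangle_pdag {}) \<in> mpdag_order V S A"
proof -
  have K: "{(a, c), (b, c)} \<subseteq> tri a b c" "{(a, c), (b, c)} \<subseteq> tri b a c" by (auto simp: tri_def)
  show "(path_pdag {(a, c)}, triangle_pdag {(a, c), (b, c)}) \<in> mpdag_order V S A"
  proof (rule mpdag_orderI)
    fix D assume "D \<in> represented_dags V (path_pdag {(a, c)})"
    then have D: "D \<in> compatible_dags V {(a, b), (a, c)} {(a, c)}" by (simp add: path_mpdag)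
    then have "(a, c) \<in> D" by (simp add: compatible_path_iff)
    then have "D = {(a, b), (a, c)} \<or> D = {(b, a), (a, c)}"
      using compatible_path_cases[OF D] abc by auto
    then show "\<exists>D'\<in>represented_dags V (triangle_pdag {(a, c), (b, c)}).
        dag_model V S A D \<subseteq> dag_model V S A D'"
      using path_triangle_models tris_compatible(1,2) K by (auto simp: triangle_mpdag)
  qed (rule path_mpdag(1) triangle_mpdag(1); use K in simp)+
  show "(path_pdag {}, triangle_pdag {}) \<in> mpdag_order V S A"
  proof (rule mpdag_orderI)
    fix D assume "D \<in> represented_dags V (path_pdag {})"
    then have "D \<in> compatible_dags V {(a, b), (a, c)} {}" by (simp add: path_mpdag)
    then show "\<exists>D'\<in>represented_dags V (triangle_pdag {}). dag_model V S A D \<subseteq> dag_model V S A D'"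
      using compatible_path_cases path_triangle_models tris_compatible(1,2,4)
      by (simp add: triangle_mpdag) blast
  qed (simp_all add: path_mpdag triangle_mpdag)
qed

section \<open>The two covering relations\<close>

lemma skeleton_path:
  "K \<subseteq> {(a, b), (a, c)} \<Longrightarrow> D \<in> represented_dags V (path_pdag K) \<Longrightarrow> skeleton D = {{a, b}, {a, c}}"
  by (simp add: path_mpdag compatible_path_iff)

text \<open>An element in between has the same skeleton, so its DAGs lie between the two represented
  sets. Its directed edges then form a subset of \<open>{(a, c)}\<close>, and either choice makes it
  equal to one of the ends.\<close>

lemma covers_path_path: "covers (mpdag_order V S A) (path_pdag {(a, c)}) (path_pdag {})"
  unfolding covers_def
proof (intro conjI notI)
  show "(path_pdag {(a, c)}, path_pdag {}) \<in> mpdag_order V S A" by (rule order_path_path)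
  show "path_pdag {(a, c)} = path_pdag {} \<Longrightarrow> False" using directed_path by auto
  assume "\<exists>z. (path_pdag {(a, c)}, z) \<in> mpdag_order V S A \<and> path_pdag {(a, c)} \<noteq> z \<and>
    (z, path_pdag {}) \<in> mpdag_order V S A \<and> z \<noteq> path_pdag {}"
  then obtain z where z: "(path_pdag {(a, c)}, z) \<in> mpdag_order V S A" "path_pdag {(a, c)} \<noteq> z"
    "(z, path_pdag {}) \<in> mpdag_order V S A" "z \<noteq> path_pdag {}" by blast
  then have zV: "z \<in> mpdags V" by (simp add: mpdag_order_def)
  let ?R = "represented_dags V"
  have pV: "path_pdag {} \<in> mpdags V" "path_pdag {(a, c)} \<in> mpdags V" by (simp_all add: path_mpdag)
  obtain D D1 D2 where D: "D \<in> ?R z" "D1 \<in> ?R (path_pdag {(a, c)})" "D2 \<in> ?R (path_pdag {})"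
    using represented_dags_nonempty[OF zV] represented_dags_nonempty[OF pV(1)]
      represented_dags_nonempty[OF pV(2)] by auto
  have sk: "skeleton D1 = {{a, b}, {a, c}}" "skeleton D2 = {{a, b}, {a, c}}"
    using skeleton_path D by auto
  have "skeleton D1 \<subseteq> skeleton D" "skeleton D \<subseteq> skeleton D2"
    using mpdag_order_skeleton[OF z(1) D(2,1)] mpdag_order_skeleton[OF z(3) D(1,3)] .
  then have sub: "?R (path_pdag {(a, c)}) \<subseteq> ?R z" "?R z \<subseteq> ?R (path_pdag {})"
    using mpdag_order_represented_subset[OF z(1) D(2,1)]
      mpdag_order_represented_subset[OF z(3) D(1,3)] sk by auto
  \<comment> \<open>Directed edges are intersections over the represented DAGs, so inclusion is
    reversed.\<close>
  then have "directed z \<subseteq> directed (path_pdag {(a, c)})"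
    using directed_eq_Inter[OF zV] directed_eq_Inter[OF pV(2)] by (simp add: Inter_anti_mono)
  then have "directed z = {} \<or> directed z = {(a, c)}" using directed_path(2) by auto
  then show False
    using mpdag_eqI[OF zV pV(1) sub(2)] mpdag_eqI[OF pV(2) zV sub(1)] z(2,4) directed_path by auto
qed

text \<open>An element in between has the skeleton of one of the ends. With the path as skeleton it
  represents all DAGs of the undirected path; with the triangle, only DAGs of the undirected
  triangle. In both cases it has no directed edge and thus equals that end.\<close>

lemma covers_path_triangle: "covers (mpdag_order V S A) (path_pdag {}) (triangle_pdag {})"
  unfolding covers_def
proof (intro conjI notI)
  let ?R = "represented_dags V"
  have V: "path_pdag {} \<in> mpdags V" "triangle_pdag {} \<in> mpdags V" by (simp_all add: path_mpdag triangle_mpdag)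
  obtain D1 D2 where D12: "D1 \<in> ?R (path_pdag {})" "D2 \<in> ?R (triangle_pdag {})"
    using represented_dags_nonempty[OF V(1)] represented_dags_nonempty[OF V(2)] by auto
  have sk: "skeleton D1 = {{a, b}, {a, c}}" "skeleton D2 = {{a, b}, {a, c}, {b, c}}"
    using skeleton_path[OF _ D12(1)] D12(2) by (simp_all add: triangle_mpdag compatible_triangle_iff)
  show "(path_pdag {}, triangle_pdag {}) \<in> mpdag_order V S A" by (rule order_path_triangle)
  have "{b, c} \<notin> skeleton D1" "{b, c} \<in> skeleton D2"
    using abc unfolding sk by (simp_all add: doubleton_eq_iff)
  then show "path_pdag {} = triangle_pdag {} \<Longrightarrow> False"
    using represented_dags_skeleton[OF V(2) _ D12(2), of D1] D12(1) by simp
  assume "\<exists>z. (path_pdag {}, z) \<in> mpdag_order V S A \<and> path_pdag {} \<noteq> z \<and>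
    (z, triangle_pdag {}) \<in> mpdag_order V S A \<and> z \<noteq> triangle_pdag {}"
  then obtain z where z: "(path_pdag {}, z) \<in> mpdag_order V S A" "path_pdag {} \<noteq> z"
    "(z, triangle_pdag {}) \<in> mpdag_order V S A" "z \<noteq> triangle_pdag {}" by blast
  then have zV: "z \<in> mpdags V" by (simp add: mpdag_order_def)
  obtain D where D: "D \<in> ?R z" using represented_dags_nonempty[OF zV] by blast
  have sk_lower: "skeleton D1 \<subseteq> skeleton D" and sk_upper: "skeleton D \<subseteq> skeleton D2"
    using mpdag_order_skeleton[OF z(1) D12(1) D] mpdag_order_skeleton[OF z(3) D D12(2)] .
  show False
  proof (cases "{b, c} \<in> skeleton D")
    case False
    then have "skeleton D \<subseteq> skeleton D1" using sk_upper unfolding sk by blast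
    then have sub: "?R (path_pdag {}) \<subseteq> ?R z"
      by (rule mpdag_order_represented_subset[OF z(1) D12(1) D])
    then have "directed z \<subseteq> directed (path_pdag {})"
      using directed_eq_Inter[OF zV] directed_eq_Inter[OF V(1)] by (simp add: Inter_anti_mono)
    then show False using mpdag_eqI[OF V(1) zV sub] z(2) directed_path(1) by simp
  next
    case True
    then have "skeleton D2 \<subseteq> skeleton D" using sk_lower unfolding sk by blast
    then have sub: "?R z \<subseteq> ?R (triangle_pdag {})"
      by (rule mpdag_order_represented_subset[OF z(3) D D12(2)])
    \<comment> \<open>A DAG above \<open>x \<rightarrow> a \<rightarrow> y\<close> must be the transitive orientation of the triangle; the two
        choices of \<open>x\<close> give opposite orientations, so \<open>z\<close> has no directed edge.\<close>
    have tri_in: "tri x a y \<in> ?R z"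
      if xy: "{x, y} = {b, c}" "{(x, a), (a, y)} \<in> ?R (path_pdag {})" for x y
    proof -
      obtain E where E: "E \<in> ?R z" "{(x, a), (a, y)} \<subseteq> E"
        using z(1) xy(2) by (rule mpdag_order_dag_subset)
      have acyc: "acyclic E" using E(1) represented_dags_subset[OF zV] by (auto simp: dags_def)
      have skE: "skeleton E = {{a, b}, {a, c}, {b, c}}"
        using represented_dags_skeleton[OF V(2)] sub E(1) D12(2) sk(2) by blast
      have "{x, y} \<in> skeleton E" using skE xy(1) by simp
      moreover have "(y, x) \<notin> E"
      proof
        assume "(y, x) \<in> E"
        then have "(x, x) \<in> E\<^sup>+" using E(2) by (meson insert_subset r_into_trancl trancl_trans)
        then show False using acyc by (simp add: acyclic_def)
      qed
      ultimately have "(x, y) \<in> E" by (auto simp: doubleton_skeleton_iff)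
      then have "tri x a y \<subseteq> E" using E(2) by (auto simp: tri_def)
      moreover have "skeleton (tri x a y) = skeleton E"
        using xy(1) unfolding skE skeleton_tri by (auto simp: doubleton_eq_iff insert_commute)
      ultimately show ?thesis using subdag_eqI[OF _ acyc] E(1) by (metis order_refl)
    qed
    have "{(b, a), (a, c)} \<in> ?R (path_pdag {})" "{(c, a), (a, b)} \<in> ?R (path_pdag {})"
      using paths_compatible by (simp_all add: path_mpdag)
    then have "tri b a c \<in> ?R z" "tri c a b \<in> ?R z" using tri_in by auto
    then have "directed z \<subseteq> tri b a c \<inter> tri c a b" using directed_eq_Inter[OF zV] by blast
    then have "directed z = {}" using abc by (auto simp: tri_def)
    then show False using mpdag_eqI[OF zV V(2) sub] z(4) directed_triangle(1) by simp
  qed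
qed

lemma not_graded: "\<not> graded_poset (mpdags V) (mpdag_order V S A)"
proof
  let ?r = "mpdag_order V S A"
  assume "graded_poset (mpdags V) ?r"
  then obtain rank :: "'v pdag \<Rightarrow> nat" where
    "\<forall>x\<in>mpdags V. \<forall>y\<in>mpdags V. covers ?r x y \<longrightarrow> rank y = rank x + 1"
    by (auto simp: graded_poset_def)
  then have rank: "rank y = rank x + 1" if "covers ?r x y" for x y
    using that by (auto simp: covers_def mpdag_order_def)
  have less: "rank x < rank y" if "(x, y) \<in> ?r" "x \<noteq> y" for x y
    using finite_mpdags[OF finite_V] trans_mpdag_order antisym_mpdag_order _ _ rank that
    by (rule rank_strict_mono) (auto simp: mpdag_order_def)
  \<comment> \<open>Strictness of the three steps is read off from the directed edges.\<close>
  have "directed (path_pdag {(a, c)}) \<noteq> directed (triangle_pdag {(a, c), (b, c)})"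
    "directed (triangle_pdag {(a, c), (b, c)}) \<noteq> directed (triangle_pdag {(b, c)})"
    "directed (triangle_pdag {(b, c)}) \<noteq> directed (triangle_pdag {})"
    unfolding directed_path directed_triangle using abc by auto
  then have "rank (path_pdag {(a, c)}) < rank (triangle_pdag {(a, c), (b, c)})"
    "rank (triangle_pdag {(a, c), (b, c)}) < rank (triangle_pdag {(b, c)})"
    "rank (triangle_pdag {(b, c)}) < rank (triangle_pdag {})"
    by (auto intro: less order_path_triangle(1) order_triangles)
  moreover have "rank (triangle_pdag {}) = rank (path_pdag {(a, c)}) + 2"
    using rank[OF covers_path_path] rank[OF covers_path_triangle] by simp
  ultimately show False by simp
qed

end

theorem proposition9:
  fixes V :: "'v set"
    and S :: "'v \<Rightarrow> 'x measure"
    and A :: "('v, 'x) schedule measure"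
  assumes "finite V" and "card V \<ge> 4"
    and "state_spaces V S"
    and "suitable_schedule_space V S A"
  shows "\<not> graded_poset (mpdags V) (mpdag_order V S A)"
proof -
  have "3 \<le> card V" using assms(2) by simp
  then obtain W where "W \<subseteq> V" "card W = 3"
    by (rule obtain_subset_with_card_n)
  then obtain a b c where "a \<in> V" "b \<in> V" "c \<in> V" "a \<noteq> b" "a \<noteq> c" "b \<noteq> c"
    by (auto simp: card_3_iff)
  then interpret three_vertices V S A a b c
    using assms by unfold_locales auto
  show ?thesis by (rule not_graded)
qed

end
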